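(* Let $X$ be a variety over an algebraically closed field $k$ of characteristic $\neq2$, let $V\to X$ be a vector bundle of rank $7$ and $M$ a line bundle on $X$, and let $\gamma:\bigwedge^3V\to M^{\otimes3}$ and $\beta:\mathrm{Sym}^2V\to M^{\otimes2}$ be (locally) compatible forms, with $\beta$ nondegenerate. Suppose there is a splitting $V=L_1\oplus\cdots\oplus L_7$ into line bundles such that $L_1$ is $\gamma$-isotropic, and $L_1\oplus L_2\oplus L_3=E_{L_1}$. Then the map $V\otimes V\to V^*\otimes M^{\otimes3}\cong V\otimes M$ induced by $\gamma$ and $\beta$ restricts to an isomorphism $L_2\otimes L_3\xrightarrow{\sim}L_1\otimes M$.
   Context: On a vector space, an alternating trilinear form $\gamma$ and a nondegenerate symmetric bilinear form $\beta$ are compatible if $2\gamma(u,v,\gamma(u,v,\cdot)^\dagger)=\beta(u,u)\beta(v,v)-\beta(u,v)^2$ for all $u,v$, where $\dagger:V^*\to V$ is the inverse of $v\mapsto\beta(v,\cdot)$. Forms on bundles with values in $M^{\otimes3}$, $M^{\otimes2}$ are locally compatible if, after locally trivializing $M$ (with the induced trivializations of $M^{\otimes2},M^{\otimes3}$), they are compatible on fibers. A $2$-dimensional subspace of a fiber is $\gamma$-isotropic if $\gamma(u,v,\cdot)\equiv0$ for all $u,v$ in it; a line is $\gamma$-isotropic if it lies in a $2$-dimensional $\gamma$-isotropic subspace; a line subbundle is $\gamma$-isotropic if each fiber is. For a $\gamma$-isotropic line subbundle $L\subset V$, $E_L=\ker(V\to L^*\otimes V^*\otimes M^{\otimes3})$,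 the kernel of the map defined by $\gamma$ (a rank $3$ subbundle). The identification $V^*\otimes M^{\otimes3}\cong V\otimes M$ comes from the isomorphism $V\cong V^*\otimes M^{\otimes2}$ given by $\beta$. *)

theory Defs
  imports
    "HOL-Analysis.Analysis"
    "HOL-Computational_Algebra.Computational_Algebra"
    "HOL-Library.Function_Algebras"
begin

section \<open>Varieties\<close>

text \<open>
  Varieties over an algebraically closed field are treated as spaces with functions (Serre):
  a topological space with a sheaf of \<open>k\<close>-valued functions that is quasi-compact, separated and
  locally isomorphic to an affine algebraic set.  This is the category of reduced separated
  schemes of finite type over \<open>k\<close>; irreducibility is not required.  Functions are total in HOL,
  so \<open>reg X U\<close> contains all total functions whose restriction to \<open>U\<close> is regular.
\<close>

record ('k, 'x) fun_space =
  topol :: "'x topology"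
  reg :: "'x set \<Rightarrow> ('x \<Rightarrow> 'k) set"

definition sheaf_of_functions :: "('k, 'x) fun_space \<Rightarrow> bool" where
  "sheaf_of_functions X \<longleftrightarrow>
     (\<forall>U W f. openin (topol X) U \<longrightarrow> openin (topol X) W \<longrightarrow> W \<subseteq> U \<longrightarrow> f \<in> reg X U \<longrightarrow> f \<in> reg X W) \<and>
     (\<forall>U f. openin (topol X) U \<longrightarrow>
        (\<forall>x\<in>U. \<exists>W g. openin (topol X) W \<and> x \<in> W \<and> W \<subseteq> U \<and> g \<in> reg X W \<and> (\<forall>y\<in>W. f y = g y)) \<longrightarrow>
        f \<in> reg X U)"

definition open_subspace :: "('k, 'x) fun_space \<Rightarrow> 'x set \<Rightarrow> ('k, 'x) fun_space" where
  "open_subspace X U = \<lparr>topol = subtopology (topol X) U, reg = reg X\<rparr>"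

definition fun_space_iso ::
  "('k, 'x) fun_space \<Rightarrow> ('k, 'y) fun_space \<Rightarrow> ('x \<Rightarrow> 'y) \<Rightarrow> bool" where
  "fun_space_iso X Y \<phi> \<longleftrightarrow>
     homeomorphic_map (topol X) (topol Y) \<phi> \<and>
     (\<forall>U f. openin (topol Y) U \<longrightarrow>
        (f \<in> reg Y U \<longleftrightarrow> (\<lambda>x. f (\<phi> x)) \<in> reg X {x \<in> topspace (topol X). \<phi> x \<in> U}))"

text \<open>Points of \<open>k\<^sup>n\<close> are sequences vanishing from index \<open>n\<close> on.\<close>

definition affine_space :: "nat \<Rightarrow> (nat \<Rightarrow> 'k::field) set" where
  "affine_space n = {p. \<forall>i\<ge>n. p i = 0}"

inductive_set poly_fun :: "nat \<Rightarrow> ((nat \<Rightarrow> 'k::field) \<Rightarrow> 'k) set" for n where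
  const: "(\<lambda>_. c) \<in> poly_fun n"
| coord: "i < n \<Longrightarrow> (\<lambda>p. p i) \<in> poly_fun n"
| add: "f \<in> poly_fun n \<Longrightarrow> g \<in> poly_fun n \<Longrightarrow> (\<lambda>p. f p + g p) \<in> poly_fun n"
| mult: "f \<in> poly_fun n \<Longrightarrow> g \<in> poly_fun n \<Longrightarrow> (\<lambda>p. f p * g p) \<in> poly_fun n"

definition algebraic_set :: "nat \<Rightarrow> (nat \<Rightarrow> 'k::field) set \<Rightarrow> bool" where
  "algebraic_set n Z \<longleftrightarrow>
     (\<exists>S. S \<subseteq> poly_fun n \<and> Z = {p \<in> affine_space n. \<forall>g\<in>S. g p = 0})"

definition zariski :: "nat \<Rightarrow> (nat \<Rightarrow> 'k::field) set \<Rightarrow> (nat \<Rightarrow> 'k) topology" where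
  "zariski n Z = topology_generated_by {{p \<in> Z. g p \<noteq> 0} | g. g \<in> poly_fun n}"

definition affine_fun_space ::
  "nat \<Rightarrow> (nat \<Rightarrow> 'k::field) set \<Rightarrow> ('k, nat \<Rightarrow> 'k) fun_space" where
  "affine_fun_space n Z =
     \<lparr>topol = zariski n Z,
      reg = (\<lambda>U. {h. \<forall>p\<in>U. \<exists>W. openin (zariski n Z) W \<and> p \<in> W \<and> W \<subseteq> U \<and>
                (\<exists>f\<in>poly_fun n. \<exists>g\<in>poly_fun n. \<forall>q\<in>W. g q \<noteq> 0 \<and> h q = f q / g q)})\<rparr>"

definition prevariety :: "('k::field, 'x) fun_space \<Rightarrow> bool" where
  "prevariety X \<longleftrightarrow>
     sheaf_of_functions X \<and> compact_space (topol X) \<and>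
     (\<forall>x\<in>topspace (topol X). \<exists>U n Z \<phi>. openin (topol X) U \<and> x \<in> U \<and> algebraic_set n Z \<and>
        fun_space_iso (open_subspace X U) (affine_fun_space n Z) \<phi>)"

text \<open>
  The topology of the product prevariety \<open>X \<times> X\<close>: its basic open sets are the loci in \<open>U \<times> W\<close>
  where an element of the image of \<open>\<O>(U) \<otimes> \<O>(W)\<close> does not vanish.
\<close>

definition square_topology :: "('k::field, 'x) fun_space \<Rightarrow> ('x \<times> 'x) topology" where
  "square_topology X = topology_generated_by
     {{(x, y). x \<in> U \<and> y \<in> W \<and> (\<Sum>i<n. a i x * b i y) \<noteq> 0} | U W (n::nat) a b.
        openin (topol X) U \<and> openin (topol X) W \<and> (\<forall>i<n. a i \<in> reg X U \<and> b i \<in> reg X W)}"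

definition variety :: "('k::field, 'x) fun_space \<Rightarrow> bool" where
  "variety X \<longleftrightarrow>
     prevariety X \<and> closedin (square_topology X) {(x, x) | x. x \<in> topspace (topol X)}"

section \<open>Linear algebra on subspaces of an ambient vector space\<close>

definition linear_on ::
  "('k::field \<Rightarrow> 'v::ab_group_add \<Rightarrow> 'v) \<Rightarrow> ('k \<Rightarrow> 'w::ab_group_add \<Rightarrow> 'w) \<Rightarrow>
   'v set \<Rightarrow> 'w set \<Rightarrow> ('v \<Rightarrow> 'w) \<Rightarrow> bool" where
  "linear_on s1 s2 F G f \<longleftrightarrow>
     (\<forall>v\<in>F. f v \<in> G) \<and>
     (\<forall>v\<in>F. \<forall>w\<in>F. f (v + w) = f v + f w) \<and>
     (\<forall>c. \<forall>v\<in>F. f (s1 c v) = s2 c (f v))"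

definition is_basis ::
  "('k::field \<Rightarrow> 'v::ab_group_add \<Rightarrow> 'v) \<Rightarrow> 'v set \<Rightarrow> 'v list \<Rightarrow> bool" where
  "is_basis s F vs \<longleftrightarrow>
     distinct vs \<and> \<not> module.dependent s (set vs) \<and> module.span s (set vs) = F"

definition bilinear_form ::
  "('k::field \<Rightarrow> 'v::ab_group_add \<Rightarrow> 'v) \<Rightarrow> ('k \<Rightarrow> 'w::ab_group_add \<Rightarrow> 'w) \<Rightarrow>
   ('v \<Rightarrow> 'w \<Rightarrow> 'k) \<Rightarrow> bool" where
  "bilinear_form s1 s2 b \<longleftrightarrow>
     (\<forall>w. Vector_Spaces.linear s1 (*) (\<lambda>v. b v w)) \<and> (\<forall>v. Vector_Spaces.linear s2 (*) (b v))"

text \<open>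
  Tensors are realised in the dual of the space of bilinear forms on the ambient spaces, \<open>v \<otimes> w\<close>
  being evaluation at \<open>(v, w)\<close>; over a field, \<open>F \<otimes> G\<close> is the span of the \<open>v \<otimes> w\<close> with
  \<open>v \<in> F\<close>, \<open>w \<in> G\<close>.  Thus for subspaces \<open>F' \<subseteq> F\<close>, \<open>G' \<subseteq> G\<close> the tensor product \<open>F' \<otimes> G'\<close> is
  literally a subspace of \<open>F \<otimes> G\<close>.
\<close>

type_synonym ('k, 'v, 'w) tensor = "('v \<Rightarrow> 'w \<Rightarrow> 'k) \<Rightarrow> 'k"

definition fun_scale :: "'k::field \<Rightarrow> ('a \<Rightarrow> 'k) \<Rightarrow> ('a \<Rightarrow> 'k)" where
  "fun_scale c f = (\<lambda>x. c * f x)"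

definition pure_tensor ::
  "('k::field \<Rightarrow> 'v::ab_group_add \<Rightarrow> 'v) \<Rightarrow> ('k \<Rightarrow> 'w::ab_group_add \<Rightarrow> 'w) \<Rightarrow>
   'v \<Rightarrow> 'w \<Rightarrow> ('k, 'v, 'w) tensor" where
  "pure_tensor s1 s2 v w = (\<lambda>b. if bilinear_form s1 s2 b then b v w else 0)"

definition tensor_space ::
  "('k::field \<Rightarrow> 'v::ab_group_add \<Rightarrow> 'v) \<Rightarrow> ('k \<Rightarrow> 'w::ab_group_add \<Rightarrow> 'w) \<Rightarrow>
   'v set \<Rightarrow> 'w set \<Rightarrow> ('k, 'v, 'w) tensor set" where
  "tensor_space s1 s2 F G = module.span fun_scale {pure_tensor s1 s2 v w | v w. v \<in> F \<and> w \<in> G}"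

text \<open>
  The linear map on \<open>F \<otimes> G\<close> induced by a map \<open>B\<close> bilinear on \<open>F \<times> G\<close>:
  \<open>\<Sum> v\<^sub>i \<otimes> w\<^sub>i\<close> is sent to \<open>\<Sum> B v\<^sub>i w\<^sub>i\<close>.
\<close>

definition tensor_lift ::
  "('k::field \<Rightarrow> 'v::ab_group_add \<Rightarrow> 'v) \<Rightarrow> ('k \<Rightarrow> 'w::ab_group_add \<Rightarrow> 'w) \<Rightarrow>
   'v set \<Rightarrow> 'w set \<Rightarrow> ('v \<Rightarrow> 'w \<Rightarrow> 'u::ab_group_add) \<Rightarrow> ('k, 'v, 'w) tensor \<Rightarrow> 'u" where
  "tensor_lift s1 s2 F G B t =
     (THE y. \<exists>ps. set ps \<subseteq> F \<times> G \<and> t = (\<Sum>(v, w)\<leftarrow>ps. pure_tensor s1 s2 v w) \<and>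
        y = (\<Sum>(v, w)\<leftarrow>ps. B v w))"

section \<open>Vector bundles\<close>

text \<open>
  A vector bundle is given by its fibres and an atlas of local frames with regular transition
  functions.  The fibres are subspaces of one ambient vector space, which plays no role beyond
  carrying the operations (one may always take the direct sum of all fibres).
\<close>

record ('k, 'x, 'v) vbundle =
  scale :: "'k \<Rightarrow> 'v \<Rightarrow> 'v"
  fibre :: "'x \<Rightarrow> 'v set"
  frames :: "('x set \<times> ('x \<Rightarrow> 'v) list) set"

definition regular_coords ::
  "('k::field, 'x) fun_space \<Rightarrow> ('k \<Rightarrow> 'v::ab_group_add \<Rightarrow> 'v) \<Rightarrow> 'x set \<Rightarrow>
   ('x \<Rightarrow> 'v) list \<Rightarrow> ('x \<Rightarrow> 'v) \<Rightarrow> bool" where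
  "regular_coords X sc U es s \<longleftrightarrow>
     (\<exists>c. (\<forall>i<length es. c i \<in> reg X U) \<and>
          (\<forall>x\<in>U. s x = (\<Sum>i<length es. sc (c i x) ((es ! i) x))))"

definition vector_bundle ::
  "('k::field, 'x) fun_space \<Rightarrow> nat \<Rightarrow> ('k, 'x, 'v::ab_group_add) vbundle \<Rightarrow> bool" where
  "vector_bundle X r E \<longleftrightarrow>
     vector_space (scale E) \<and>
     (\<forall>x\<in>topspace (topol X). module.subspace (scale E) (fibre E x)) \<and>
     \<Union> (fst ` frames E) = topspace (topol X) \<and>
     (\<forall>(U, es)\<in>frames E. openin (topol X) U \<and> length es = r \<and>
        (\<forall>x\<in>U. is_basis (scale E) (fibre E x) (map (\<lambda>e. e x) es))) \<and>
     (\<forall>(U, es)\<in>frames E. \<forall>(W, fs)\<in>frames E. \<forall>f\<in>set fs.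
        regular_coords X (scale E) (U \<inter> W) es f)"

abbreviation line_bundle ::
  "('k::field, 'x) fun_space \<Rightarrow> ('k, 'x, 'v::ab_group_add) vbundle \<Rightarrow> bool" where
  "line_bundle X L \<equiv> vector_bundle X 1 L"

definition regular_section ::
  "('k::field, 'x) fun_space \<Rightarrow> ('k, 'x, 'v::ab_group_add) vbundle \<Rightarrow> 'x set \<Rightarrow> ('x \<Rightarrow> 'v) \<Rightarrow> bool"
  where
  "regular_section X E U s \<longleftrightarrow>
     openin (topol X) U \<and> (\<forall>x\<in>U. s x \<in> fibre E x) \<and>
     (\<forall>(W, es)\<in>frames E. regular_coords X (scale E) (U \<inter> W) es s)"

definition bundle_map ::
  "('k::field, 'x) fun_space \<Rightarrow> ('k, 'x, 'v::ab_group_add) vbundle \<Rightarrow>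
   ('k, 'x, 'w::ab_group_add) vbundle \<Rightarrow> ('x \<Rightarrow> 'v \<Rightarrow> 'w) \<Rightarrow> bool" where
  "bundle_map X E F \<phi> \<longleftrightarrow>
     (\<forall>x\<in>topspace (topol X). linear_on (scale E) (scale F) (fibre E x) (fibre F x) (\<phi> x)) \<and>
     (\<forall>U s. regular_section X E U s \<longrightarrow> regular_section X F U (\<lambda>x. \<phi> x (s x)))"

definition bundle_iso ::
  "('k::field, 'x) fun_space \<Rightarrow> ('k, 'x, 'v::ab_group_add) vbundle \<Rightarrow>
   ('k, 'x, 'w::ab_group_add) vbundle \<Rightarrow> ('x \<Rightarrow> 'v \<Rightarrow> 'w) \<Rightarrow> bool" where
  "bundle_iso X E F \<phi> \<longleftrightarrow>
     bundle_map X E F \<phi> \<and>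
     (\<exists>\<psi>. bundle_map X F E \<psi> \<and>
        (\<forall>x\<in>topspace (topol X). (\<forall>v\<in>fibre E x. \<psi> x (\<phi> x v) = v) \<and>
           (\<forall>w\<in>fibre F x. \<phi> x (\<psi> x w) = w)))"

text \<open>
  A fibrewise injective map of bundles has locally constant rank, so a bundle whose fibres lie in
  those of \<open>V\<close> is a subbundle as soon as the inclusion is regular.
\<close>

definition subbundle ::
  "('k::field, 'x) fun_space \<Rightarrow> ('k, 'x, 'v::ab_group_add) vbundle \<Rightarrow>
   ('k, 'x, 'v) vbundle \<Rightarrow> bool" where
  "subbundle X L V \<longleftrightarrow> scale L = scale V \<and> bundle_map X L V (\<lambda>x v. v)"

definition is_direct_sum ::
  "('k::field, 'x) fun_space \<Rightarrow> nat set \<Rightarrow> (nat \<Rightarrow> ('k, 'x, 'v::ab_group_add) vbundle) \<Rightarrow>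
   ('k, 'x, 'v) vbundle \<Rightarrow> bool" where
  "is_direct_sum X I L V \<longleftrightarrow>
     (\<forall>i\<in>I. subbundle X (L i) V) \<and>
     (\<forall>x\<in>topspace (topol X). \<forall>v\<in>fibre V x.
        \<exists>!l. l \<in> (\<Pi>\<^sub>E i\<in>I. fibre (L i) x) \<and> v = (\<Sum>i\<in>I. l i))"

definition tensor_bundle ::
  "('k::field, 'x, 'v::ab_group_add) vbundle \<Rightarrow> ('k, 'x, 'w::ab_group_add) vbundle \<Rightarrow>
   ('k, 'x, ('k, 'v, 'w) tensor) vbundle" (infixl \<open>\<otimes>\<^sub>B\<close> 70) where
  "E \<otimes>\<^sub>B F =
     \<lparr>scale = fun_scale,
      fibre = (\<lambda>x. tensor_space (scale E) (scale F) (fibre E x) (fibre F x)),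
      frames = {(U \<inter> W, [\<lambda>x. pure_tensor (scale E) (scale F) (e x) (f x). e \<leftarrow> es, f \<leftarrow> fs]) |
                  U es W fs. (U, es) \<in> frames E \<and> (W, fs) \<in> frames F}\<rparr>"

abbreviation tensor_square ::
  "('k::field, 'x, 'm::ab_group_add) vbundle \<Rightarrow> ('k, 'x, ('k, 'm, 'm) tensor) vbundle" where
  "tensor_square M \<equiv> M \<otimes>\<^sub>B M"

abbreviation tensor_cube ::
  "('k::field, 'x, 'm::ab_group_add) vbundle \<Rightarrow>
   ('k, 'x, ('k, ('k, 'm, 'm) tensor, 'm) tensor) vbundle" where
  "tensor_cube M \<equiv> M \<otimes>\<^sub>B M \<otimes>\<^sub>B M"

section \<open>Compatible forms\<close>

definition symmetric_on ::
  "('k::field \<Rightarrow> 'v::ab_group_add \<Rightarrow> 'v) \<Rightarrow> ('k \<Rightarrow> 'n::ab_group_add \<Rightarrow> 'n) \<Rightarrow>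
   'v set \<Rightarrow> 'n set \<Rightarrow> ('v \<Rightarrow> 'v \<Rightarrow> 'n) \<Rightarrow> bool" where
  "symmetric_on s1 s2 F N \<beta> \<longleftrightarrow>
     (\<forall>u\<in>F. linear_on s1 s2 F N (\<beta> u)) \<and> (\<forall>u\<in>F. \<forall>v\<in>F. \<beta> u v = \<beta> v u)"

definition nondegenerate_on :: "'v::ab_group_add set \<Rightarrow> ('v \<Rightarrow> 'v \<Rightarrow> 'n::zero) \<Rightarrow> bool" where
  "nondegenerate_on F \<beta> \<longleftrightarrow> (\<forall>v\<in>F. (\<forall>w\<in>F. \<beta> v w = 0) \<longrightarrow> v = 0)"

definition alternating_on ::
  "('k::field \<Rightarrow> 'v::ab_group_add \<Rightarrow> 'v) \<Rightarrow> ('k \<Rightarrow> 'n::ab_group_add \<Rightarrow> 'n) \<Rightarrow>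
   'v set \<Rightarrow> 'n set \<Rightarrow> ('v \<Rightarrow> 'v \<Rightarrow> 'v \<Rightarrow> 'n) \<Rightarrow> bool" where
  "alternating_on s1 s2 F N \<gamma> \<longleftrightarrow>
     (\<forall>u\<in>F. \<forall>v\<in>F. linear_on s1 s2 F N (\<lambda>w. \<gamma> u v w) \<and> linear_on s1 s2 F N (\<lambda>w. \<gamma> u w v) \<and>
        linear_on s1 s2 F N (\<lambda>w. \<gamma> w u v)) \<and>
     (\<forall>u\<in>F. \<forall>v\<in>F. \<gamma> u u v = 0 \<and> \<gamma> u v u = 0 \<and> \<gamma> v u u = 0)"

definition dagger :: "'v set \<Rightarrow> ('v \<Rightarrow> 'v \<Rightarrow> 'k) \<Rightarrow> ('v \<Rightarrow> 'k) \<Rightarrow> 'v" where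
  "dagger F \<beta> f = (THE v. v \<in> F \<and> (\<forall>w\<in>F. \<beta> v w = f w))"

definition compatible ::
  "('k::field \<Rightarrow> 'v::ab_group_add \<Rightarrow> 'v) \<Rightarrow> 'v set \<Rightarrow>
   ('v \<Rightarrow> 'v \<Rightarrow> 'v \<Rightarrow> 'k) \<Rightarrow> ('v \<Rightarrow> 'v \<Rightarrow> 'k) \<Rightarrow> bool" where
  "compatible s F \<gamma> \<beta> \<longleftrightarrow>
     alternating_on s (*) F UNIV \<gamma> \<and> symmetric_on s (*) F UNIV \<beta> \<and> nondegenerate_on F \<beta> \<and>
     (\<forall>u\<in>F. \<forall>v\<in>F. 2 * \<gamma> u v (dagger F \<beta> (\<gamma> u v)) = \<beta> u u * \<beta> v v - (\<beta> u v)\<^sup>2)"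

text \<open>Bundle maps \<open>\<And>\<^sup>3V \<rightarrow> N\<close> and \<open>Sym\<^sup>2V \<rightarrow> N\<close>, as regular alternating trilinear and symmetric
  bilinear forms.\<close>

definition alternating_form ::
  "('k::field, 'x) fun_space \<Rightarrow> ('k, 'x, 'v::ab_group_add) vbundle \<Rightarrow>
   ('k, 'x, 'n::ab_group_add) vbundle \<Rightarrow> ('x \<Rightarrow> 'v \<Rightarrow> 'v \<Rightarrow> 'v \<Rightarrow> 'n) \<Rightarrow> bool" where
  "alternating_form X V N \<gamma> \<longleftrightarrow>
     (\<forall>x\<in>topspace (topol X). alternating_on (scale V) (scale N) (fibre V x) (fibre N x) (\<gamma> x)) \<and>
     (\<forall>U r s t. regular_section X V U r \<longrightarrow> regular_section X V U s \<longrightarrow> regular_section X V U t \<longrightarrow>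
        regular_section X N U (\<lambda>x. \<gamma> x (r x) (s x) (t x)))"

definition symmetric_bilinear_form ::
  "('k::field, 'x) fun_space \<Rightarrow> ('k, 'x, 'v::ab_group_add) vbundle \<Rightarrow>
   ('k, 'x, 'n::ab_group_add) vbundle \<Rightarrow> ('x \<Rightarrow> 'v \<Rightarrow> 'v \<Rightarrow> 'n) \<Rightarrow> bool" where
  "symmetric_bilinear_form X V N \<beta> \<longleftrightarrow>
     (\<forall>x\<in>topspace (topol X). symmetric_on (scale V) (scale N) (fibre V x) (fibre N x) (\<beta> x)) \<and>
     (\<forall>U r s. regular_section X V U r \<longrightarrow> regular_section X V U s \<longrightarrow>
        regular_section X N U (\<lambda>x. \<beta> x (r x) (s x)))"

definition nondegenerate_form ::
  "('k::field, 'x) fun_space \<Rightarrow> ('k, 'x, 'v::ab_group_add) vbundle \<Rightarrow>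
   ('x \<Rightarrow> 'v \<Rightarrow> 'v \<Rightarrow> 'n::zero) \<Rightarrow> bool" where
  "nondegenerate_form X V \<beta> \<longleftrightarrow> (\<forall>x\<in>topspace (topol X). nondegenerate_on (fibre V x) (\<beta> x))"

definition coord :: "('k \<Rightarrow> 'n \<Rightarrow> 'n) \<Rightarrow> 'n \<Rightarrow> 'n \<Rightarrow> 'k" where
  "coord s e n = (THE c. n = s c e)"

text \<open>A trivialization of \<open>M\<close> over \<open>U\<close> is a nowhere vanishing regular section \<open>m\<close>; the induced
  trivializations of \<open>M\<^sup>\<otimes>\<^sup>2\<close> and \<open>M\<^sup>\<otimes>\<^sup>3\<close> are \<open>m \<otimes> m\<close> and \<open>m \<otimes> m \<otimes> m\<close>.\<close>

definition locally_compatible ::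
  "('k::field, 'x) fun_space \<Rightarrow> ('k, 'x, 'v::ab_group_add) vbundle \<Rightarrow>
   ('k, 'x, 'm::ab_group_add) vbundle \<Rightarrow>
   ('x \<Rightarrow> 'v \<Rightarrow> 'v \<Rightarrow> 'v \<Rightarrow> ('k, ('k, 'm, 'm) tensor, 'm) tensor) \<Rightarrow>
   ('x \<Rightarrow> 'v \<Rightarrow> 'v \<Rightarrow> ('k, 'm, 'm) tensor) \<Rightarrow> bool" where
  "locally_compatible X V M \<gamma> \<beta> \<longleftrightarrow>
     (\<forall>x\<in>topspace (topol X). \<exists>U m. x \<in> U \<and> regular_section X M U m \<and> (\<forall>y\<in>U. m y \<noteq> 0) \<and>
        (\<forall>y\<in>U.
           let m2 = pure_tensor (scale M) (scale M) (m y) (m y);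
               m3 = pure_tensor (scale (tensor_square M)) (scale M) m2 (m y)
           in compatible (scale V) (fibre V y)
                (\<lambda>u v w. coord (scale (tensor_cube M)) m3 (\<gamma> y u v w))
                (\<lambda>u v. coord (scale (tensor_square M)) m2 (\<beta> y u v))))"

definition isotropic_plane ::
  "('k::field \<Rightarrow> 'v::ab_group_add \<Rightarrow> 'v) \<Rightarrow> 'v set \<Rightarrow> ('v \<Rightarrow> 'v \<Rightarrow> 'v \<Rightarrow> 'n::zero) \<Rightarrow> 'v set \<Rightarrow> bool"
  where
  "isotropic_plane s F \<gamma> P \<longleftrightarrow>
     P \<subseteq> F \<and> module.subspace s P \<and> vector_space.dim s P = 2 \<and>
     (\<forall>u\<in>P. \<forall>v\<in>P. \<forall>w\<in>F. \<gamma> u v w = 0)"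

definition isotropic_line_subbundle ::
  "('k::field, 'x) fun_space \<Rightarrow> ('k, 'x, 'v::ab_group_add) vbundle \<Rightarrow>
   ('x \<Rightarrow> 'v \<Rightarrow> 'v \<Rightarrow> 'v \<Rightarrow> 'n::zero) \<Rightarrow> ('k, 'x, 'v) vbundle \<Rightarrow> bool" where
  "isotropic_line_subbundle X V \<gamma> L \<longleftrightarrow>
     line_bundle X L \<and> subbundle X L V \<and>
     (\<forall>x\<in>topspace (topol X). \<exists>P. isotropic_plane (scale V) (fibre V x) (\<gamma> x) P \<and> fibre L x \<subseteq> P)"

text \<open>The fibres of \<open>E\<^sub>L = ker (V \<rightarrow> L\<^sup>* \<otimes> V\<^sup>* \<otimes> M\<^sup>\<otimes>\<^sup>3)\<close>, where \<open>v\<close> is sent to the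
  bilinear map \<open>\<gamma> v\<close> on \<open>L \<times> V\<close>.\<close>

definition kernel_fibre ::
  "('k, 'x, 'v) vbundle \<Rightarrow> ('x \<Rightarrow> 'v \<Rightarrow> 'v \<Rightarrow> 'v \<Rightarrow> 'n::zero) \<Rightarrow> ('k, 'x, 'v) vbundle \<Rightarrow> 'x \<Rightarrow> 'v set"
  where
  "kernel_fibre V \<gamma> L x = {v \<in> fibre V x. \<forall>l\<in>fibre L x. \<forall>w\<in>fibre V x. \<gamma> x v l w = 0}"

section \<open>The map \<open>V \<otimes> V \<rightarrow> V \<otimes> M\<close>\<close>

text \<open>
  A fibre of \<open>V\<^sup>* \<otimes> N\<close> is the space of linear maps from the fibre of \<open>V\<close> to that of \<open>N\<close>,
  extended by zero to the ambient space.  On fibres, \<open>beta_ident\<close> is the isomorphism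
  \<open>V \<otimes> M \<rightarrow> (V\<^sup>* \<otimes> M\<^sup>\<otimes>\<^sup>2) \<otimes> M = V\<^sup>* \<otimes> M\<^sup>\<otimes>\<^sup>3\<close> given by \<open>v \<otimes> m \<mapsto> \<beta>(v, -) \<otimes> m\<close>, and
  \<open>gamma_contract\<close> is \<open>V \<otimes> V \<rightarrow> V\<^sup>* \<otimes> M\<^sup>\<otimes>\<^sup>3\<close>, \<open>u \<otimes> v \<mapsto> \<gamma>(u, v, -)\<close>.
\<close>

definition gamma_contract ::
  "('k::field, 'x, 'v::ab_group_add) vbundle \<Rightarrow>
   ('x \<Rightarrow> 'v \<Rightarrow> 'v \<Rightarrow> 'v \<Rightarrow> 'n::ab_group_add) \<Rightarrow> 'x \<Rightarrow> ('k, 'v, 'v) tensor \<Rightarrow> 'v \<Rightarrow> 'n" where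
  "gamma_contract V \<gamma> x =
     tensor_lift (scale V) (scale V) (fibre V x) (fibre V x)
       (\<lambda>u v w. if w \<in> fibre V x then \<gamma> x u v w else 0)"

definition beta_ident ::
  "('k::field, 'x, 'v::ab_group_add) vbundle \<Rightarrow> ('k, 'x, 'm::ab_group_add) vbundle \<Rightarrow>
   ('x \<Rightarrow> 'v \<Rightarrow> 'v \<Rightarrow> ('k, 'm, 'm) tensor) \<Rightarrow>
   'x \<Rightarrow> ('k, 'v, 'm) tensor \<Rightarrow> 'v \<Rightarrow> ('k, ('k, 'm, 'm) tensor, 'm) tensor" where
  "beta_ident V M \<beta> x =
     tensor_lift (scale V) (scale M) (fibre V x) (fibre M x)
       (\<lambda>v m w. if w \<in> fibre V x
          then pure_tensor (scale (tensor_square M)) (scale M) (\<beta> x v w) m else 0)"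

definition induced_map ::
  "('k::field, 'x, 'v::ab_group_add) vbundle \<Rightarrow> ('k, 'x, 'm::ab_group_add) vbundle \<Rightarrow>
   ('x \<Rightarrow> 'v \<Rightarrow> 'v \<Rightarrow> 'v \<Rightarrow> ('k, ('k, 'm, 'm) tensor, 'm) tensor) \<Rightarrow>
   ('x \<Rightarrow> 'v \<Rightarrow> 'v \<Rightarrow> ('k, 'm, 'm) tensor) \<Rightarrow>
   'x \<Rightarrow> ('k, 'v, 'v) tensor \<Rightarrow> ('k, 'v, 'm) tensor" where
  "induced_map V M \<gamma> \<beta> x t =
     inv_into (fibre (V \<otimes>\<^sub>B M) x) (beta_ident V M \<beta> x) (gamma_contract V \<gamma> x t)"

end

theory Submission
  imports Defs
begin

text \<open>
  On a fibre of \<open>V\<close>, trivialise \<open>M\<close> and let \<open>u \<times> v\<close> be the vector that represents \<open>\<gamma>(u, v, -)\<close>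
  through \<open>\<beta>\<close>.  Compatibility says \<open>2 |u \<times> v|\<^sup>2 = |u|\<^sup>2 |v|\<^sup>2 - \<langle>u, v\<rangle>\<^sup>2\<close>, and since \<open>\<gamma>\<close> is alternating,
  polarising this in characteristic other than \<open>2\<close> gives
  \<open>2 (u \<times> (z \<times> w) + z \<times> (u \<times> w)) = \<langle>u, w\<rangle> z + \<langle>z, w\<rangle> u - 2 \<langle>u, z\<rangle> w\<close>.
  Let \<open>a\<close>, \<open>b\<close>, \<open>c\<close> span the fibres of \<open>L\<^sub>1\<close>, \<open>L\<^sub>2\<close>, \<open>L\<^sub>3\<close> and let \<open>E = ker (a \<times> -)\<close> be their span.  The
  identity shows that \<open>E\<close> is totally isotropic for \<open>\<beta>\<close> and that \<open>d = b \<times> c\<close> lies in \<open>E\<close> and is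
  annihilated by \<open>b\<close> and \<open>c\<close>; expanding \<open>d\<close> in \<open>a\<close>, \<open>b\<close>, \<open>c\<close> then leaves \<open>d = p a\<close>.  If \<open>d\<close> were zero,
  \<open>b\<close> would annihilate all of \<open>E\<close>; evaluating the polarised norm identity on \<open>a\<close>, \<open>b\<close> and vectors
  \<open>a'\<close>, \<open>b'\<close> paired with them contradicts this.  So \<open>p \<noteq> 0\<close>
  (\<open>cross_kernel_plane\<close>), and \<open>b \<otimes> c\<close> is sent to a nonzero multiple of \<open>a \<otimes> m\<close>
  (\<open>contraction_on_fibre\<close>, \<open>induced_map_on_frame\<close>).

  Both bundles are line bundles, so it remains to see that this multiple \<open>h\<close> is a regular function of
  the point (\<open>line_bundle_iso_local\<close>).  Inverting the matrix of \<open>\<beta>\<close> can be avoided: by definition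
  \<open>\<gamma>(b, c, e) = h \<beta>(a, e) m\<close> for every local section \<open>e\<close> of \<open>V\<close>, and near a given point a member
  \<open>e\<close> of a frame can be chosen with \<open>\<beta>(a, e)\<close> invertible.  Then \<open>h\<close> is a quotient of regular functions
  with nonvanishing denominator (\<open>multiplier_regular\<close>), and such quotients are regular because this
  holds on affine algebraic sets (\<open>reg_quotient_local\<close>).
\<close>

section \<open>Regular functions on a prevariety\<close>

lemma reg_restrict:
  assumes "sheaf_of_functions X" "openin (topol X) U" "openin (topol X) W" "W \<subseteq> U" "f \<in> reg X U"
  shows "f \<in> reg X W"
  using assms unfolding sheaf_of_functions_def by blast

lemma reg_glue:
  assumes "sheaf_of_functions X" "openin (topol X) U"
    and "\<And>x. x \<in> U \<Longrightarrow>
      \<exists>W g. openin (topol X) W \<and> x \<in> W \<and> W \<subseteq> U \<and> g \<in> reg X W \<and> (\<forall>y\<in>W. f y = g y)"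
  shows "f \<in> reg X U"
  by (rule assms(1)[unfolded sheaf_of_functions_def, THEN conjunct2, rule_format, OF assms(2,3)])

lemma reg_cong:
  assumes "sheaf_of_functions X" "openin (topol X) U" "g \<in> reg X U" "\<And>x. x \<in> U \<Longrightarrow> f x = g x"
  shows "f \<in> reg X U"
  using assms by (intro reg_glue[OF assms(1,2)]) blast

lemma prevariety_sheaf: "prevariety X \<Longrightarrow> sheaf_of_functions X"
  by (simp add: prevariety_def)

lemma openin_zariski_nonvanishing:
  assumes "openin (zariski n Z) W" "g \<in> poly_fun n"
  shows "openin (zariski n Z) {p \<in> W. g p \<noteq> 0}"
proof -
  have "W \<subseteq> Z"
    using openin_subset[OF assms(1)] by (auto simp: zariski_def)
  then have "{p \<in> W. g p \<noteq> 0} = W \<inter> {p \<in> Z. g p \<noteq> 0}" by auto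
  moreover have "openin (zariski n Z) {p \<in> Z. g p \<noteq> 0}"
    unfolding zariski_def by (rule topology_generated_by_Basis) (use assms(2) in blast)
  ultimately show ?thesis using assms(1) by (simp add: openin_Int)
qed

text \<open>
  What is needed of an affine chart, without mentioning its coordinates: on \<open>D\<close> the regular functions
  are exactly the local quotients of functions in \<open>P\<close>, the pullbacks of the polynomials.
\<close>
definition fraction_chart ::
  "('k::field, 'x) fun_space \<Rightarrow> 'x set \<Rightarrow> ('x \<Rightarrow> 'k) set \<Rightarrow> bool" where
  "fraction_chart X D P \<longleftrightarrow>
     openin (topol X) D \<and> (\<lambda>_. 1) \<in> P \<and> (\<forall>f\<in>P. \<forall>g\<in>P. (\<lambda>y. f y * g y) \<in> P) \<and>
     (\<forall>N. openin (topol X) N \<longrightarrow> N \<subseteq> D \<longrightarrow>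
        (\<forall>g\<in>P. openin (topol X) {y \<in> N. g y \<noteq> 0}) \<and>
        (\<forall>f\<in>P. \<forall>g\<in>P. (\<forall>y\<in>N. g y \<noteq> 0) \<longrightarrow> (\<lambda>y. f y / g y) \<in> reg X N) \<and>
        (\<forall>h\<in>reg X N. \<forall>y\<in>N. \<exists>W f g. openin (topol X) W \<and> y \<in> W \<and> W \<subseteq> N \<and> f \<in> P \<and> g \<in> P \<and>
           (\<forall>z\<in>W. g z \<noteq> 0 \<and> h z = f z / g z)))"

lemma fraction_chartD:
  assumes "fraction_chart X D P"
  shows "openin (topol X) D" "(\<lambda>_. 1) \<in> P" "f \<in> P \<Longrightarrow> g \<in> P \<Longrightarrow> (\<lambda>y. f y * g y) \<in> P"
    and "openin (topol X) N \<Longrightarrow> N \<subseteq> D \<Longrightarrow> g \<in> P \<Longrightarrow> openin (topol X) {y \<in> N. g y \<noteq> 0}"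
    and "openin (topol X) N \<Longrightarrow> N \<subseteq> D \<Longrightarrow> f \<in> P \<Longrightarrow> g \<in> P \<Longrightarrow> (\<And>y. y \<in> N \<Longrightarrow> g y \<noteq> 0) \<Longrightarrow>
      (\<lambda>y. f y / g y) \<in> reg X N"
  using assms by (simp_all add: fraction_chart_def)

lemma fraction_chart_obtain:
  assumes "fraction_chart X D P" "openin (topol X) N" "N \<subseteq> D" "h \<in> reg X N" "y \<in> N"
  obtains W f g where "openin (topol X) W" "y \<in> W" "W \<subseteq> N" "f \<in> P" "g \<in> P"
    "\<And>z. z \<in> W \<Longrightarrow> g z \<noteq> 0" "\<And>z. z \<in> W \<Longrightarrow> h z = f z / g z"
proof -
  have "\<exists>W f g. openin (topol X) W \<and> y \<in> W \<and> W \<subseteq> N \<and> f \<in> P \<and> g \<in> P \<and>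
      (\<forall>z\<in>W. g z \<noteq> 0 \<and> h z = f z / g z)"
    using assms by (simp add: fraction_chart_def)
  then obtain W f g where "openin (topol X) W" "y \<in> W" "W \<subseteq> N" "f \<in> P" "g \<in> P"
    "\<forall>z\<in>W. g z \<noteq> 0 \<and> h z = f z / g z" by blast
  then show thesis using that[of W f g] by blast
qed

lemma exists_fraction_chart:
  assumes X: "prevariety X" and U: "openin (topol X) U" "x \<in> U"
  obtains D P where "fraction_chart X D P" "x \<in> D" "D \<subseteq> U"
proof -
  have sh: "sheaf_of_functions X" using X by (rule prevariety_sheaf)
  have "x \<in> topspace (topol X)" using U openin_subset by blast
  then obtain A n Z \<phi> where A: "openin (topol X) A" "x \<in> A"
    and iso: "fun_space_iso (open_subspace X A) (affine_fun_space n Z) \<phi>"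
    using X unfolding prevariety_def by meson
  have Asub: "A \<subseteq> topspace (topol X)" using A openin_subset by blast
  have hom: "homeomorphic_map (subtopology (topol X) A) (zariski n Z) \<phi>"
    and regiff: "\<And>W f. openin (zariski n Z) W \<Longrightarrow>
      f \<in> reg (affine_fun_space n Z) W \<longleftrightarrow> (\<lambda>x. f (\<phi> x)) \<in> reg X {x \<in> A. \<phi> x \<in> W}"
    using iso Asub unfolding fun_space_iso_def
    by (auto simp: open_subspace_def affine_fun_space_def Int_absorb1)
  have inj: "inj_on \<phi> A"
    using homeomorphic_imp_injective_map[OF hom] Asub by (simp add: Int_absorb1)
  have im: "openin (zariski n Z) (\<phi> ` N)" if "openin (topol X) N" "N \<subseteq> A" for N
    using hom that homeomorphic_imp_open_map[OF hom] A(1)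
    by (simp add: open_map_def openin_open_subtopology)
  have pre: "openin (topol X) {y \<in> A. \<phi> y \<in> W}" if "openin (zariski n Z) W" for W
  proof -
    have "openin (subtopology (topol X) A) {y \<in> topspace (subtopology (topol X) A). \<phi> y \<in> W}"
      using homeomorphic_imp_continuous_map[OF hom] that by (simp add: continuous_map_def)
    then show ?thesis using A(1) Asub by (simp add: openin_open_subtopology Int_absorb1)
  qed
  \<comment> \<open>By injectivity a subset of \<open>A\<close> is the preimage of its image, so \<open>regiff\<close> transports regularity on \<open>N\<close> to \<open>\<phi> ` N\<close>.\<close>
  have pre_im: "{y \<in> A. \<phi> y \<in> \<phi> ` N} = N" if "N \<subseteq> A" for N
    using inj that by (auto simp: inj_on_def)
  define P where "P = (\<lambda>f y. f (\<phi> y)) ` poly_fun n"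
  show thesis
  proof (rule that[of "A \<inter> U" P])
    show "x \<in> A \<inter> U" "A \<inter> U \<subseteq> U" using A U by auto
    have oAU: "openin (topol X) (A \<inter> U)" using A U by auto
    have one: "(\<lambda>_. 1) \<in> P" unfolding P_def by (rule image_eqI[of _ _ "\<lambda>_. 1"]) (auto intro: poly_fun.const)
    have mult: "(\<lambda>y. f y * g y) \<in> P" if fg: "f \<in> P" "g \<in> P" for f g
    proof -
      obtain f' g' where "f = (\<lambda>y. f' (\<phi> y))" "g = (\<lambda>y. g' (\<phi> y))" "f' \<in> poly_fun n" "g' \<in> poly_fun n"
        using fg by (auto simp: P_def)
      then show ?thesis unfolding P_def
        by (intro image_eqI[of _ _ "\<lambda>p. f' p * g' p"]) (auto intro: poly_fun.mult)
    qed
    have nonvan: "openin (topol X) {y \<in> N. g y \<noteq> 0}" if N: "openin (topol X) N" "N \<subseteq> A \<inter> U" "g \<in> P" for N g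
    proof -
      obtain g' where g: "g = (\<lambda>y. g' (\<phi> y))" "g' \<in> poly_fun n" using N by (auto simp: P_def)
      have "openin (topol X) {y \<in> A. \<phi> y \<in> {p \<in> \<phi> ` N. g' p \<noteq> 0}}"
        using N g by (intro pre openin_zariski_nonvanishing im) auto
      moreover have "{y \<in> A. \<phi> y \<in> {p \<in> \<phi> ` N. g' p \<noteq> 0}} = {y \<in> N. g y \<noteq> 0}"
        using pre_im[of N] N g by auto
      ultimately show ?thesis by simp
    qed
    have quot: "(\<lambda>y. f y / g y) \<in> reg X N"
      if N: "openin (topol X) N" "N \<subseteq> A \<inter> U" "f \<in> P" "g \<in> P" "\<forall>y\<in>N. g y \<noteq> 0" for N f g
    proof -
      obtain f' g' where fg: "f = (\<lambda>y. f' (\<phi> y))" "g = (\<lambda>y. g' (\<phi> y))"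
        "f' \<in> poly_fun n" "g' \<in> poly_fun n"
        using N by (auto simp: P_def)
      have o: "openin (zariski n Z) (\<phi> ` N)" using N by (intro im) auto
      moreover have "\<exists>f\<in>poly_fun n. \<exists>g\<in>poly_fun n. \<forall>q\<in>\<phi> ` N. g q \<noteq> 0 \<and> f' q / g' q = f q / g q"
        by (rule bexI[of _ f'], rule bexI[of _ g']) (use fg N in auto)
      ultimately have "(\<lambda>p. f' p / g' p) \<in> reg (affine_fun_space n Z) (\<phi> ` N)"
        unfolding affine_fun_space_def by (auto intro!: exI[of _ "\<phi> ` N"])
      then show ?thesis
        using regiff[OF o, of "\<lambda>p. f' p / g' p"] pre_im[of N] N fg by simp
    qed
    have frac: "\<exists>W f g. openin (topol X) W \<and> y \<in> W \<and> W \<subseteq> N \<and> f \<in> P \<and> g \<in> P \<and>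
        (\<forall>z\<in>W. g z \<noteq> 0 \<and> h z = f z / g z)"
      if N: "openin (topol X) N" "N \<subseteq> A \<inter> U" "h \<in> reg X N" "y \<in> N" for N h y
    proof -
      have o: "openin (zariski n Z) (\<phi> ` N)" using N by (intro im) auto
      define h' where "h' = (\<lambda>p. h (the_inv_into A \<phi> p))"
      have "(\<lambda>x. h' (\<phi> x)) \<in> reg X N"
        using N the_inv_into_f_f[OF inj]
        by (intro reg_cong[OF sh N(1,3)]) (auto simp: h'_def)
      then have "h' \<in> reg (affine_fun_space n Z) (\<phi> ` N)"
        using regiff[OF o, of h'] pre_im[of N] N by simp
      then obtain W f g where W: "openin (zariski n Z) W" "\<phi> y \<in> W" "W \<subseteq> \<phi> ` N"
        "f \<in> poly_fun n" "g \<in> poly_fun n" "\<forall>q\<in>W. g q \<noteq> 0 \<and> h' q = f q / g q"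
        using N(4) unfolding affine_fun_space_def by fastforce
      have sub: "{z \<in> A. \<phi> z \<in> W} \<subseteq> N" using W(3) pre_im[of N] N by blast
      show ?thesis
      proof (intro exI conjI)
        show "openin (topol X) {z \<in> A. \<phi> z \<in> W}" using W by (intro pre)
        show "(\<lambda>z. f (\<phi> z)) \<in> P" "(\<lambda>z. g (\<phi> z)) \<in> P" using W by (auto simp: P_def)
        show "\<forall>z\<in>{z \<in> A. \<phi> z \<in> W}. g (\<phi> z) \<noteq> 0 \<and> h z = f (\<phi> z) / g (\<phi> z)"
          using W the_inv_into_f_f[OF inj] by (auto simp: h'_def)
      qed (use W N sub in auto)
    qed
    show "fraction_chart X (A \<inter> U) P"
      unfolding fraction_chart_def
      by (intro conjI allI impI ballI oAU one mult nonvan quot frac) auto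
  qed
qed

lemma reg_one:
  assumes "prevariety X" "openin (topol X) U"
  shows "(\<lambda>_. 1) \<in> reg X U"
proof (rule reg_glue[OF prevariety_sheaf[OF assms(1)] assms(2)])
  fix x assume "x \<in> U"
  then obtain D P where D: "fraction_chart X D P" "x \<in> D" "D \<subseteq> U"
    using exists_fraction_chart[OF assms] by metis
  then have "(\<lambda>_. 1 / 1) \<in> reg X D" by (intro fraction_chartD(5)[OF D(1)] fraction_chartD[OF D(1)]) auto
  with D fraction_chartD(1)[OF D(1)]
  show "\<exists>W g. openin (topol X) W \<and> x \<in> W \<and> W \<subseteq> U \<and> g \<in> reg X W \<and> (\<forall>y\<in>W. 1 = g y)"
    by (intro exI[of _ D] exI[of _ "\<lambda>_. 1 / 1"]) auto
qed

text \<open>Two regular functions can be written as fractions over the same chart and on the same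
  neighbourhood, which reduces their product and quotient to those of fractions.\<close>
lemma common_fractions:
  assumes X: "prevariety X" and U: "openin (topol X) U" "x \<in> U" and h: "h \<in> reg X U" "k \<in> reg X U"
  obtains D P W f g f' g' where "fraction_chart X D P" "openin (topol X) W" "x \<in> W" "W \<subseteq> D" "W \<subseteq> U"
    "f \<in> P" "g \<in> P" "f' \<in> P" "g' \<in> P"
    "\<And>z. z \<in> W \<Longrightarrow> g z \<noteq> 0" "\<And>z. z \<in> W \<Longrightarrow> h z = f z / g z"
    "\<And>z. z \<in> W \<Longrightarrow> g' z \<noteq> 0" "\<And>z. z \<in> W \<Longrightarrow> k z = f' z / g' z"
proof -
  obtain D P where D: "fraction_chart X D P" "x \<in> D" "D \<subseteq> U"
    using exists_fraction_chart[OF X U] by metis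
  note oD = fraction_chartD(1)[OF D(1)]
  note restr = reg_restrict[OF prevariety_sheaf[OF X] U(1) oD D(3)]
  obtain W1 f g where W1: "openin (topol X) W1" "x \<in> W1" "W1 \<subseteq> D" "f \<in> P" "g \<in> P"
    "\<And>z. z \<in> W1 \<Longrightarrow> g z \<noteq> 0" "\<And>z. z \<in> W1 \<Longrightarrow> h z = f z / g z"
    by (rule fraction_chart_obtain[OF D(1) oD order_refl restr[OF h(1)] D(2)]) (rule that)
  obtain W2 f' g' where W2: "openin (topol X) W2" "x \<in> W2" "W2 \<subseteq> D" "f' \<in> P" "g' \<in> P"
    "\<And>z. z \<in> W2 \<Longrightarrow> g' z \<noteq> 0" "\<And>z. z \<in> W2 \<Longrightarrow> k z = f' z / g' z"
    by (rule fraction_chart_obtain[OF D(1) oD order_refl restr[OF h(2)] D(2)]) (rule that)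
  show thesis
    by (rule that[OF D(1), of "W1 \<inter> W2" f g f' g']) (use W1 W2 D in auto)
qed

lemma reg_quotient_local:
  assumes X: "prevariety X" and U: "openin (topol X) U" "x \<in> U"
    and h: "h \<in> reg X U" "k \<in> reg X U" and nz: "k x \<noteq> 0"
  obtains W where "openin (topol X) W" "x \<in> W" "W \<subseteq> U" "\<And>y. y \<in> W \<Longrightarrow> k y \<noteq> 0"
    "(\<lambda>y. h y / k y) \<in> reg X W"
proof -
  obtain D P V f g f' g' where D: "fraction_chart X D P" and V: "openin (topol X) V" "x \<in> V"
      "V \<subseteq> D" "V \<subseteq> U"
    and P: "f \<in> P" "g \<in> P" "f' \<in> P" "g' \<in> P"
    and fg: "\<And>z. z \<in> V \<Longrightarrow> g z \<noteq> 0" "\<And>z. z \<in> V \<Longrightarrow> h z = f z / g z"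
      "\<And>z. z \<in> V \<Longrightarrow> g' z \<noteq> 0" "\<And>z. z \<in> V \<Longrightarrow> k z = f' z / g' z"
    by (rule common_fractions[OF X U h]) (rule that)
  define W where "W = {y \<in> V. f' y \<noteq> 0}"
  have oW: "openin (topol X) W"
    unfolding W_def by (rule fraction_chartD(4)[OF D V(1,3) P(3)])
  have "(\<lambda>y. (f y * g' y) / (g y * f' y)) \<in> reg X W"
    using V P fg by (intro fraction_chartD(5)[OF D oW] fraction_chartD(3)[OF D]) (auto simp: W_def)
  then have "(\<lambda>y. h y / k y) \<in> reg X W"
    by (rule reg_cong[OF prevariety_sheaf[OF X] oW]) (use fg in \<open>auto simp: W_def\<close>)
  moreover have "x \<in> W" "W \<subseteq> U" "\<And>y. y \<in> W \<Longrightarrow> k y \<noteq> 0"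
    using V fg nz by (auto simp: W_def)
  ultimately show thesis using that oW by blast
qed

lemma reg_inverse:
  assumes X: "prevariety X" and U: "openin (topol X) U"
    and k: "k \<in> reg X U" "\<And>x. x \<in> U \<Longrightarrow> k x \<noteq> 0"
  shows "(\<lambda>y. 1 / k y) \<in> reg X U"
proof (rule reg_glue[OF prevariety_sheaf[OF X] U])
  fix x assume x: "x \<in> U"
  obtain W where "openin (topol X) W" "x \<in> W" "W \<subseteq> U" "(\<lambda>y. 1 / k y) \<in> reg X W"
    using reg_quotient_local[OF X U x reg_one[OF X U] k(1) k(2)[OF x]] by metis
  then show "\<exists>W g. openin (topol X) W \<and> x \<in> W \<and> W \<subseteq> U \<and> g \<in> reg X W \<and> (\<forall>y\<in>W. 1 / k y = g y)"
    by blast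
qed

lemma reg_mult:
  assumes X: "prevariety X" and U: "openin (topol X) U" and h: "h \<in> reg X U" "k \<in> reg X U"
  shows "(\<lambda>y. h y * k y) \<in> reg X U"
proof (rule reg_glue[OF prevariety_sheaf[OF X] U])
  fix x assume x: "x \<in> U"
  obtain D P V f g f' g' where D: "fraction_chart X D P" and V: "openin (topol X) V" "x \<in> V"
      "V \<subseteq> D" "V \<subseteq> U"
    and P: "f \<in> P" "g \<in> P" "f' \<in> P" "g' \<in> P"
    and fg: "\<And>z. z \<in> V \<Longrightarrow> g z \<noteq> 0" "\<And>z. z \<in> V \<Longrightarrow> h z = f z / g z"
      "\<And>z. z \<in> V \<Longrightarrow> g' z \<noteq> 0" "\<And>z. z \<in> V \<Longrightarrow> k z = f' z / g' z"
    by (rule common_fractions[OF X U x h]) (rule that)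
  have "(\<lambda>y. (f y * f' y) / (g y * g' y)) \<in> reg X V"
    using V P fg by (intro fraction_chartD(5)[OF D] fraction_chartD(3)[OF D]) auto
  then show "\<exists>W g. openin (topol X) W \<and> x \<in> W \<and> W \<subseteq> U \<and> g \<in> reg X W \<and> (\<forall>y\<in>W. h y * k y = g y)"
    using V fg by (intro exI[of _ V] exI conjI) auto
qed

section \<open>Tensors over a field\<close>

lemma vector_space_times: "vector_space ((*) :: 'k::field \<Rightarrow> 'k \<Rightarrow> 'k)"
  by standard (auto simp: algebra_simps)

lemma vector_space_pointwise:
  assumes "vector_space s"
  shows "vector_space (\<lambda>c f x. s c (f x))"
proof -
  interpret vector_space s by fact
  show ?thesis by standard (auto simp: scale_right_distrib scale_left_distrib fun_eq_iff)
qed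

lemma vector_space_fun_scale: "vector_space fun_scale"
  using vector_space_pointwise[OF vector_space_times] by (simp add: fun_scale_def[abs_def])

lemma fun_scale_add: "fun_scale (a + b) f = fun_scale a f + fun_scale b f"
  by (simp add: fun_scale_def fun_eq_iff distrib_right)

lemma fun_scale_scale: "fun_scale a (fun_scale b f) = fun_scale (a * b) f"
  by (simp add: fun_scale_def mult.assoc)

lemma functional_nonzero:
  assumes "vector_space s" "y \<noteq> 0"
  shows "\<exists>f. Vector_Spaces.linear s (*) f \<and> f y \<noteq> 0"
proof -
  interpret vector_space s by fact
  interpret k: vector_space "(*) :: 'a \<Rightarrow> 'a \<Rightarrow> 'a" by (rule vector_space_times)
  interpret vector_space_pair s "(*)" ..
  have "independent {y}" using assms(2) by simp
  from linear_independent_extend[OF this, of "\<lambda>_. 1"] show ?thesis by auto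
qed

text \<open>Used to extend maps from a fibre to the ambient vector space, on which the bilinear forms
  defining tensors live.\<close>
lemma projection_onto_subspace:
  assumes "vector_space s" "module.subspace s F"
  shows "\<exists>p. Vector_Spaces.linear s s p \<and> range p \<subseteq> F \<and> (\<forall>v\<in>F. p v = v)"
proof -
  interpret vector_space s by fact
  interpret vector_space_pair s s ..
  show ?thesis
    using linear_exists_left_inverse_on[OF linear_id assms(2)] by auto
qed

lemma linear_on_zero:
  assumes "linear_on s1 s2 F G f" "vector_space s1" "vector_space s2" "0 \<in> F"
  shows "f 0 = 0"
proof -
  interpret s1: vector_space s1 by fact
  interpret s2: vector_space s2 by fact
  have "f (s1 0 0) = s2 0 (f 0)" using assms(1,4) unfolding linear_on_def by blast
  then show ?thesis by simp
qed

locale tensor_factors = v: vector_space s1 + w: vector_space s2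
  for s1 :: "'k::field \<Rightarrow> 'v::ab_group_add \<Rightarrow> 'v" and s2 :: "'k \<Rightarrow> 'w::ab_group_add \<Rightarrow> 'w"
begin

sublocale t: vector_space "fun_scale :: 'k \<Rightarrow> ('k, 'v, 'w) tensor \<Rightarrow> ('k, 'v, 'w) tensor"
  by (rule vector_space_fun_scale)

abbreviation pt (infixl "\<otimes>" 75) where "v \<otimes> w \<equiv> pure_tensor s1 s2 v w"

lemma bilinear_formD:
  assumes "bilinear_form s1 s2 b"
  shows "b (v + v') w = b v w + b v' w" "b v (w + w') = b v w + b v w'"
    "b (s1 c v) w = c * b v w" "b v (s2 c w) = c * b v w"
  using assms unfolding bilinear_form_def
  by (auto dest!: spec simp: Vector_Spaces.linear_iff)

lemma pure_tensor_add_left: "(v + v') \<otimes> w = v \<otimes> w + v' \<otimes> w"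
  by (rule ext) (simp add: pure_tensor_def bilinear_formD)

lemma pure_tensor_add_right: "v \<otimes> (w + w') = v \<otimes> w + v \<otimes> w'"
  by (rule ext) (simp add: pure_tensor_def bilinear_formD)

lemma pure_tensor_scale_left: "s1 c v \<otimes> w = fun_scale c (v \<otimes> w)"
  by (rule ext) (simp add: pure_tensor_def fun_scale_def bilinear_formD)

lemma pure_tensor_scale_right: "v \<otimes> s2 c w = fun_scale c (v \<otimes> w)"
  by (rule ext) (simp add: pure_tensor_def fun_scale_def bilinear_formD)

lemma pure_tensor_zero: "0 \<otimes> w = 0" "v \<otimes> 0 = 0"
  using pure_tensor_scale_left[of 0 0 w] pure_tensor_scale_right[of v 0 0]
  by (simp_all add: t.scale_zero_left)

lemma bilinear_form_product:
  assumes "Vector_Spaces.linear s1 (*) f" "Vector_Spaces.linear s2 (*) g"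
  shows "bilinear_form s1 s2 (\<lambda>v w. f v * g w)"
  using assms unfolding bilinear_form_def Vector_Spaces.linear_iff
  by (auto simp: algebra_simps)

text \<open>Nonzero vectors are detected by functionals, and the product of two functionals is a bilinear
  form on which the pure tensor does not vanish.\<close>
lemma pure_tensor_eq_0_iff: "v \<otimes> w = 0 \<longleftrightarrow> v = 0 \<or> w = 0"
proof
  assume 0: "v \<otimes> w = 0"
  show "v = 0 \<or> w = 0"
  proof (rule ccontr)
    assume "\<not> ?thesis"
    then obtain f g where fg: "Vector_Spaces.linear s1 (*) f" "f v \<noteq> 0"
      "Vector_Spaces.linear s2 (*) g" "g w \<noteq> 0"
      using functional_nonzero[OF v.vector_space_axioms] functional_nonzero[OF w.vector_space_axioms]
      by meson
    then have "(v \<otimes> w) (\<lambda>v w. f v * g w) = f v * g w"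
      by (simp add: pure_tensor_def bilinear_form_product)
    then show False using fg 0 by simp
  qed
qed (auto simp: pure_tensor_zero)

lemma tensor_space_subspace: "t.subspace (tensor_space s1 s2 F G)"
  by (simp add: tensor_space_def)

lemma pure_tensor_in_space: "v \<in> F \<Longrightarrow> w \<in> G \<Longrightarrow> v \<otimes> w \<in> tensor_space s1 s2 F G"
  unfolding tensor_space_def by (intro t.span_base) blast

lemma tensor_space_mono:
  "F \<subseteq> F' \<Longrightarrow> tensor_space s1 s2 F G \<subseteq> tensor_space s1 s2 F' G"
  unfolding tensor_space_def by (intro t.span_mono) blast

lemma tensor_space_line:
  assumes "t \<in> tensor_space s1 s2 (v.span {v}) (w.span {w})"
  shows "\<exists>c. t = fun_scale c (v \<otimes> w)"
proof -
  have "{x \<otimes> y |x y. x \<in> v.span {v} \<and> y \<in> w.span {w}} \<subseteq> t.span {v \<otimes> w}"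
    by (auto simp: v.span_singleton w.span_singleton pure_tensor_scale_left pure_tensor_scale_right
        t.span_singleton)
  from t.span_minimal[OF this t.subspace_span] show ?thesis
    using assms by (auto simp: tensor_space_def t.span_singleton)
qed

text \<open>When the second factor is a line, every tensor is pure: the scalars move into the first factor.\<close>
lemma tensor_space_line_right:
  assumes F: "v.subspace F" and t: "t \<in> tensor_space s1 s2 F (w.span {w})"
  shows "\<exists>v\<in>F. t = v \<otimes> w"
  using t unfolding tensor_space_def
proof (induction rule: t.span_induct_alt)
  case base
  then show ?case using F by (intro bexI[of _ 0]) (auto simp: pure_tensor_zero v.subspace_0)
next
  case (step c x y)
  then obtain v v' d where "x = v \<otimes> s2 d w" "v \<in> F" "v' \<in> F" "y = v' \<otimes> w"
    by (auto simp: w.span_singleton)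
  then show ?case using F
    by (intro bexI[of _ "s1 (c * d) v + v'"])
      (auto simp: v.subspace_scale v.subspace_add pure_tensor_scale_left pure_tensor_scale_right
         pure_tensor_add_left)
qed

text \<open>
  The value of \<open>tensor_lift\<close> does not depend on how a tensor is written as a sum.  If two sums of
  values of \<open>B\<close> differed, a functional would separate them; composed with \<open>B\<close> and with projections
  onto \<open>F\<close> and \<open>G\<close> it becomes an ambient bilinear form that separates the two tensors.
\<close>
lemma bilinear_sums_agree:
  assumes s3: "vector_space s3" and F: "v.subspace F" and G: "w.subspace G"
    and B: "\<And>u. u \<in> F \<Longrightarrow> linear_on s2 s3 G UNIV (B u)"
      "\<And>u. u \<in> G \<Longrightarrow> linear_on s1 s3 F UNIV (\<lambda>v. B v u)"
    and ps: "set ps \<subseteq> F \<times> G" "set qs \<subseteq> F \<times> G"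
    and eq: "(\<Sum>(v, w)\<leftarrow>ps. v \<otimes> w) = (\<Sum>(v, w)\<leftarrow>qs. v \<otimes> w)"
  shows "(\<Sum>(v, w)\<leftarrow>ps. B v w) = (\<Sum>(v, w)\<leftarrow>qs. B v w)"
proof (rule ccontr)
  interpret u: vector_space s3 by fact
  let ?y = "(\<Sum>(v, w)\<leftarrow>ps. B v w) - (\<Sum>(v, w)\<leftarrow>qs. B v w)"
  assume "(\<Sum>(v, w)\<leftarrow>ps. B v w) \<noteq> (\<Sum>(v, w)\<leftarrow>qs. B v w)"
  then obtain f where f: "Vector_Spaces.linear s3 (*) f" "f ?y \<noteq> 0"
    using functional_nonzero[OF s3, of ?y] by auto
  obtain p where p: "Vector_Spaces.linear s1 s1 p" "range p \<subseteq> F" "\<And>v. v \<in> F \<Longrightarrow> p v = v"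
    using projection_onto_subspace[OF v.vector_space_axioms F] by blast
  obtain q where q: "Vector_Spaces.linear s2 s2 q" "range q \<subseteq> G" "\<And>v. v \<in> G \<Longrightarrow> q v = v"
    using projection_onto_subspace[OF w.vector_space_axioms G] by blast
  define b where "b = (\<lambda>v w. f (B (p v) (q w)))"
  have pF: "p v \<in> F" and qG: "q w \<in> G" for v w using p q by auto
  have "bilinear_form s1 s2 b"
    unfolding bilinear_form_def Vector_Spaces.linear_iff
    using f(1) p(1) q(1) B pF qG vector_space_times v.vector_space_axioms w.vector_space_axioms
    by (simp add: b_def Vector_Spaces.linear_iff linear_on_def)
  then have ev: "(v \<otimes> w) b = f (B v w)" if "v \<in> F" "w \<in> G" for v w
    using that p q by (simp add: pure_tensor_def b_def)
  have f_sum: "f (\<Sum>(v, w)\<leftarrow>rs. B v w) = (\<Sum>(v, w)\<leftarrow>rs. v \<otimes> w) b" if "set rs \<subseteq> F \<times> G" for rs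
    using that
  proof (induction rs)
    case Nil
    have "f (s3 0 0) = 0 * f 0" using f(1) unfolding Vector_Spaces.linear_iff by blast
    then show ?case by simp
  next
    case (Cons r rs)
    then show ?case using f(1) by (auto simp: Vector_Spaces.linear_iff ev)
  qed
  have "f ((\<Sum>(v, w)\<leftarrow>qs. B v w) + ?y) = f (\<Sum>(v, w)\<leftarrow>qs. B v w) + f ?y"
    using f(1) unfolding Vector_Spaces.linear_iff by blast
  then have "f (\<Sum>(v, w)\<leftarrow>ps. B v w) = f (\<Sum>(v, w)\<leftarrow>qs. B v w) + f ?y" by simp
  then show False using f_sum[OF ps(1)] f_sum[OF ps(2)] eq f(2) by simp
qed

lemma tensor_lift_sum:
  assumes "vector_space s3" "v.subspace F" "w.subspace G"
    and "\<And>u. u \<in> F \<Longrightarrow> linear_on s2 s3 G UNIV (B u)"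
      "\<And>u. u \<in> G \<Longrightarrow> linear_on s1 s3 F UNIV (\<lambda>v. B v u)"
    and ps: "set ps \<subseteq> F \<times> G"
  shows "tensor_lift s1 s2 F G B (\<Sum>(v, w)\<leftarrow>ps. v \<otimes> w) = (\<Sum>(v, w)\<leftarrow>ps. B v w)"
  unfolding tensor_lift_def
proof (rule the_equality)
  fix y assume "\<exists>qs. set qs \<subseteq> F \<times> G \<and> (\<Sum>(v, w)\<leftarrow>ps. v \<otimes> w) = (\<Sum>(v, w)\<leftarrow>qs. v \<otimes> w) \<and>
    y = (\<Sum>(v, w)\<leftarrow>qs. B v w)"
  then show "y = (\<Sum>(v, w)\<leftarrow>ps. B v w)" using bilinear_sums_agree[OF assms] by metis
qed (use ps in blast)

lemma tensor_lift_pure: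
  assumes "vector_space s3" "v.subspace F" "w.subspace G"
    and "\<And>u. u \<in> F \<Longrightarrow> linear_on s2 s3 G UNIV (B u)"
      "\<And>u. u \<in> G \<Longrightarrow> linear_on s1 s3 F UNIV (\<lambda>v. B v u)"
    and "v \<in> F" "w \<in> G"
  shows "tensor_lift s1 s2 F G B (v \<otimes> w) = B v w"
  using tensor_lift_sum[OF assms(1-5), of "[(v, w)]"] assms(6,7) by simp

end

section \<open>Compatible forms on a vector space\<close>

locale nondegenerate_symmetric_space = vector_space s
  for s :: "'k::field \<Rightarrow> 'v::ab_group_add \<Rightarrow> 'v" +
  fixes F :: "'v set" and \<beta> :: "'v \<Rightarrow> 'v \<Rightarrow> 'k"
  assumes subspace_F: "subspace F"
    and symmetric: "symmetric_on s (*) F UNIV \<beta>"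
    and nondegenerate: "nondegenerate_on F \<beta>"
begin

lemma F_closed [simp]:
  "0 \<in> F" "u \<in> F \<Longrightarrow> v \<in> F \<Longrightarrow> u + v \<in> F" "u \<in> F \<Longrightarrow> v \<in> F \<Longrightarrow> u - v \<in> F" "u \<in> F \<Longrightarrow> s c u \<in> F"
  using subspace_F by (auto simp: subspace_0 subspace_add subspace_diff subspace_scale)

lemma sum_in_F [simp]: "(\<And>i. i \<in> I \<Longrightarrow> f i \<in> F) \<Longrightarrow> sum f I \<in> F"
  using subspace_F by (rule subspace_sum)

lemma beta_commute: "u \<in> F \<Longrightarrow> v \<in> F \<Longrightarrow> \<beta> u v = \<beta> v u"
  using symmetric by (auto simp: symmetric_on_def)

lemma beta_right:
  assumes "u \<in> F" "v \<in> F"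
  shows "w \<in> F \<Longrightarrow> \<beta> u (v + w) = \<beta> u v + \<beta> u w" "\<beta> u (s c v) = c * \<beta> u v"
  using assms symmetric by (auto simp: symmetric_on_def linear_on_def)

lemma beta_left:
  assumes "u \<in> F" "v \<in> F"
  shows "w \<in> F \<Longrightarrow> \<beta> (v + w) u = \<beta> v u + \<beta> w u" "\<beta> (s c v) u = c * \<beta> v u"
  using assms beta_right[of u] by (simp_all add: beta_commute[of _ u])

lemma beta_zero: "u \<in> F \<Longrightarrow> \<beta> u 0 = 0" "u \<in> F \<Longrightarrow> \<beta> 0 u = 0"
  using beta_right(2)[of u 0 0] beta_left(2)[of u 0 0] by (simp_all)

lemma beta_diff:
  assumes "u \<in> F" "v \<in> F" "w \<in> F"
  shows "\<beta> u (v - w) = \<beta> u v - \<beta> u w" "\<beta> (v - w) u = \<beta> v u - \<beta> w u"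
proof -
  show "\<beta> u (v - w) = \<beta> u v - \<beta> u w"
    using beta_right(1)[OF assms(1), of "v - w" w] assms by (simp add: algebra_simps)
  then show "\<beta> (v - w) u = \<beta> v u - \<beta> w u"
    using assms by (simp add: beta_commute[of _ u])
qed

lemma beta_sum_left:
  assumes "u \<in> F" "\<And>i. i \<in> I \<Longrightarrow> f i \<in> F"
  shows "\<beta> (sum f I) u = (\<Sum>i\<in>I. \<beta> (f i) u)"
  using assms(2) by (induction I rule: infinite_finite_induct) (auto simp: beta_zero beta_left assms(1))

lemma beta_eqI:
  assumes "u \<in> F" "v \<in> F" "\<And>w. w \<in> F \<Longrightarrow> \<beta> u w = \<beta> v w"
  shows "u = v"
proof -
  have "\<forall>w\<in>F. \<beta> (u - v) w = 0" using assms by (simp add: beta_diff)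
  then have "u - v = 0"
    using nondegenerate[unfolded nondegenerate_on_def, rule_format, of "u - v"]
      F_closed(3)[OF assms(1,2)] by blast
  then show ?thesis by simp
qed

text \<open>
  By induction on \<open>B\<close>, as in the Gram-Schmidt process.  For a new vector \<open>e\<close> there is a \<open>v\<close> orthogonal
  to \<open>B\<close> with \<open>\<beta> v e \<noteq> 0\<close>, since otherwise \<open>e\<close> and its expansion in \<open>B\<close>, with coefficients taken from dual
  vectors, would pair equally with everything, which puts \<open>e\<close> in the span of \<open>B\<close>.  Adding a multiple of \<open>v\<close> adjusts the
  value at \<open>e\<close> alone.
\<close>
lemma exists_prescribed_values:
  assumes "finite B" "B \<subseteq> F" "independent B"
  shows "\<exists>v\<in>F. \<forall>e\<in>B. \<beta> v e = f e"
  using assms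
proof (induction B arbitrary: f rule: finite_induct)
  case empty
  then show ?case by (intro bexI[of _ 0]) auto
next
  case (insert e B)
  have BF: "B \<subseteq> F" "e \<in> F" and ind: "independent B" "e \<notin> span B"
    using insert.prems insert.hyps by (auto simp: independent_insert)
  have "\<exists>v\<in>F. \<forall>e'\<in>B. \<beta> v e' = (if e' = x then 1 else 0)" for x
    using insert.IH[OF BF(1) ind(1)] .
  then obtain d where d: "\<And>x. d x \<in> F" "\<And>x e'. e' \<in> B \<Longrightarrow> \<beta> (d x) e' = (if e' = x then 1 else 0)"
    by metis
  have "\<exists>v\<in>F. (\<forall>e'\<in>B. \<beta> v e' = 0) \<and> \<beta> v e \<noteq> 0"
  proof (rule ccontr)
    assume *: "\<not> ?thesis"
    let ?e = "\<Sum>x\<in>B. s (\<beta> (d x) e) x"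
    have "e = ?e"
    proof (rule beta_eqI)
      fix w assume w: "w \<in> F"
      define w' where "w' = w - (\<Sum>x\<in>B. s (\<beta> w x) (d x))"
      have w'F: "w' \<in> F" using w d by (simp add: w'_def)
      have "\<beta> w' e' = 0" if "e' \<in> B" for e'
      proof -
        have "\<beta> w' e' = \<beta> w e' - (\<Sum>x\<in>B. \<beta> w x * \<beta> (d x) e')"
          using w d BF that by (subst w'_def, subst beta_diff)
            (auto simp: beta_sum_left beta_left subset_iff)
        also have "\<dots> = 0" using that insert.hyps by (simp add: d if_distrib cong: if_cong)
        finally show ?thesis .
      qed
      then have "\<beta> w' e = 0" using * w'F by blast
      moreover have "\<beta> w' e = \<beta> w e - (\<Sum>x\<in>B. \<beta> w x * \<beta> (d x) e)"
        using w d BF by (subst w'_def, subst beta_diff)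
          (auto simp: beta_sum_left beta_left subset_iff)
      moreover have "\<beta> ?e w = (\<Sum>x\<in>B. \<beta> (d x) e * \<beta> x w)"
        using w d BF by (subst beta_sum_left) (auto simp: beta_left subset_iff)
      ultimately show "\<beta> e w = \<beta> ?e w"
        using w BF by (auto simp: beta_commute[of _ w] subset_iff mult.commute intro!: sum.cong)
    qed (use BF d in \<open>auto simp: subset_iff\<close>)
    moreover have "?e \<in> span B" by (intro span_sum span_scale span_base)
    ultimately show False using ind by simp
  qed
  then obtain v where v: "v \<in> F" "\<And>e'. e' \<in> B \<Longrightarrow> \<beta> v e' = 0" "\<beta> v e \<noteq> 0" by blast
  obtain u where u: "u \<in> F" "\<And>e'. e' \<in> B \<Longrightarrow> \<beta> u e' = f e'"
    using insert.IH[OF BF(1) ind(1)] by blast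
  show ?case
    by (rule bexI[of _ "u + s ((f e - \<beta> u e) / \<beta> v e) v"])
       (use u v BF in \<open>auto simp: beta_left subset_iff\<close>)
qed

lemma dagger_represents:
  assumes B: "finite B" "independent B" "span B = F" and f: "linear_on s (*) F UNIV f"
  shows "dagger F \<beta> f \<in> F" "w \<in> F \<Longrightarrow> \<beta> (dagger F \<beta> f) w = f w"
proof -
  have BF: "B \<subseteq> F" using B span_superset by auto
  obtain v where v: "v \<in> F" "\<And>e. e \<in> B \<Longrightarrow> \<beta> v e = f e"
    using exists_prescribed_values[OF B(1) BF B(2)] by blast
  have "w \<in> F \<and> \<beta> v w = f w" if "w \<in> span B" for w
    using that
  proof (induction rule: span_induct_alt)
    case base
    have "f (s 0 0) = 0 * f 0" using f unfolding linear_on_def by (meson F_closed(1))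
    then show ?case using v by (simp add: beta_zero)
  next
    case (step c x y)
    then show ?case using v f BF by (auto simp: linear_on_def beta_right subset_iff)
  qed
  then have "\<forall>w\<in>F. \<beta> v w = f w" using B by auto
  then have val: "\<And>w. w \<in> F \<Longrightarrow> \<beta> v w = f w" by blast
  have "dagger F \<beta> f = v"
    unfolding dagger_def
  proof (rule the_equality)
    fix y assume "y \<in> F \<and> (\<forall>w\<in>F. \<beta> y w = f w)"
    then show "y = v" using v(1) val by (intro beta_eqI) auto
  qed (use v val in blast)
  then have "dagger F \<beta> f \<in> F \<and> (\<forall>w\<in>F. \<beta> (dagger F \<beta> f) w = f w)"
    using v val by simp
  then show "dagger F \<beta> f \<in> F" "w \<in> F \<Longrightarrow> \<beta> (dagger F \<beta> f) w = f w" by auto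
qed

end

locale compatible_space = nondegenerate_symmetric_space s F \<beta>
  for s :: "'k::field \<Rightarrow> 'v::ab_group_add \<Rightarrow> 'v" and F \<beta> +
  fixes \<gamma> :: "'v \<Rightarrow> 'v \<Rightarrow> 'v \<Rightarrow> 'k" and B :: "'v set"
  assumes basis: "finite B" "independent B" "span B = F"
    and compatible: "compatible s F \<gamma> \<beta>"
    and two: "(2::'k) \<noteq> 0"
begin

definition cross :: "'v \<Rightarrow> 'v \<Rightarrow> 'v" where "cross u v = dagger F \<beta> (\<gamma> u v)"

lemma gamma_linear:
  assumes "u \<in> F" "v \<in> F"
  shows "linear_on s (*) F UNIV (\<lambda>w. \<gamma> u v w)" "linear_on s (*) F UNIV (\<lambda>w. \<gamma> u w v)"
    "linear_on s (*) F UNIV (\<lambda>w. \<gamma> w u v)"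
  using assms compatible by (auto simp: compatible_def alternating_on_def)

lemma gamma_add:
  assumes "u \<in> F" "v \<in> F" "w \<in> F" "z \<in> F"
  shows "\<gamma> u v (w + z) = \<gamma> u v w + \<gamma> u v z" "\<gamma> u (w + z) v = \<gamma> u w v + \<gamma> u z v"
    "\<gamma> (w + z) u v = \<gamma> w u v + \<gamma> z u v"
  using assms gamma_linear[of u v] by (auto simp: linear_on_def)

lemma gamma_scale:
  assumes "u \<in> F" "v \<in> F" "w \<in> F"
  shows "\<gamma> u v (s c w) = c * \<gamma> u v w" "\<gamma> u (s c w) v = c * \<gamma> u w v"
    "\<gamma> (s c w) u v = c * \<gamma> w u v"
  using assms gamma_linear[of u v] by (auto simp: linear_on_def)

lemma gamma_alternating:
  assumes "u \<in> F" "v \<in> F"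
  shows "\<gamma> u u v = 0" "\<gamma> u v u = 0" "\<gamma> v u u = 0"
  using assms compatible by (auto simp: compatible_def alternating_on_def)

lemma gamma_swap:
  assumes "u \<in> F" "v \<in> F" "w \<in> F"
  shows "\<gamma> u v w = - \<gamma> v u w" "\<gamma> u v w = - \<gamma> u w v"
proof -
  have "0 = \<gamma> (u + v) (u + v) w" "0 = \<gamma> u (v + w) (v + w)"
    using assms by (simp_all add: gamma_alternating)
  moreover have "\<gamma> (u + v) (u + v) w = \<gamma> u v w + \<gamma> v u w"
    using assms by (subst gamma_add(3)) (simp_all add: gamma_add(2) gamma_alternating)
  moreover have "\<gamma> u (v + w) (v + w) = \<gamma> u v w + \<gamma> u w v"
    using assms by (subst gamma_add(2)) (simp_all add: gamma_add(1) gamma_alternating)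
  ultimately show "\<gamma> u v w = - \<gamma> v u w" "\<gamma> u v w = - \<gamma> u w v"
    by (simp_all add: eq_neg_iff_add_eq_0)
qed

lemma cross_in_F [simp]: "u \<in> F \<Longrightarrow> v \<in> F \<Longrightarrow> cross u v \<in> F"
  and beta_cross: "u \<in> F \<Longrightarrow> v \<in> F \<Longrightarrow> w \<in> F \<Longrightarrow> \<beta> (cross u v) w = \<gamma> u v w"
  unfolding cross_def using dagger_represents[OF basis] gamma_linear by auto

lemma cross_add:
  assumes "u \<in> F" "v \<in> F" "w \<in> F"
  shows "cross u (v + w) = cross u v + cross u w" "cross (v + w) u = cross v u + cross w u"
  by (rule beta_eqI; use assms in \<open>simp add: beta_left beta_cross gamma_add\<close>)+

lemma cross_zero_iff:
  assumes "u \<in> F" "v \<in> F"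
  shows "cross u v = 0 \<longleftrightarrow> (\<forall>w\<in>F. \<gamma> u v w = 0)"
proof
  assume "cross u v = 0"
  then show "\<forall>w\<in>F. \<gamma> u v w = 0" using assms by (metis beta_cross beta_zero(2))
next
  assume "\<forall>w\<in>F. \<gamma> u v w = 0"
  then show "cross u v = 0" using assms by (intro beta_eqI) (auto simp: beta_cross beta_zero)
qed

lemma norm_cross:
  assumes "u \<in> F" "v \<in> F"
  shows "2 * \<beta> (cross u v) (cross u v) = \<beta> u u * \<beta> v v - (\<beta> u v)\<^sup>2"
  using assms compatible beta_cross[of u v "cross u v"] cross_in_F[of u v]
  by (auto simp: compatible_def cross_def)

text \<open>Polarisation of the norm identity in the second factor; the factor \<open>2\<close> that appears on both
  sides is cancelled here.\<close>
lemma beta_cross_cross: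
  assumes "u \<in> F" "v \<in> F" "w \<in> F"
  shows "2 * \<beta> (cross u v) (cross u w) = \<beta> u u * \<beta> v w - \<beta> u v * \<beta> u w"
proof -
  have "2 * (2 * \<beta> (cross u v) (cross u w)) =
     2 * \<beta> (cross u (v + w)) (cross u (v + w)) - 2 * \<beta> (cross u v) (cross u v)
       - 2 * \<beta> (cross u w) (cross u w)"
    using assms by (simp add: cross_add beta_left beta_right beta_commute[of "cross u w" "cross u v"] algebra_simps)
  also have "\<dots> = 2 * (\<beta> u u * \<beta> v w - \<beta> u v * \<beta> u w)"
    using assms by (simp add: norm_cross beta_left beta_right beta_commute[of w v] algebra_simps power2_eq_square)
  finally show ?thesis unfolding mult_left_cancel[OF two] .
qed

lemma beta_cross_cross_polarized:
  assumes "u \<in> F" "v \<in> F" "w \<in> F" "z \<in> F"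
  shows "2 * (\<beta> (cross u v) (cross z w) + \<beta> (cross z v) (cross u w)) =
    2 * \<beta> u z * \<beta> v w - \<beta> u v * \<beta> z w - \<beta> z v * \<beta> u w"
  using beta_cross_cross[of "u + z" v w] beta_cross_cross[of u v w] beta_cross_cross[of z v w] assms
  by (simp add: cross_add beta_left beta_right beta_commute[of z u] algebra_simps)

text \<open>This is the identity \<open>2 (u \<times> (z \<times> w) + z \<times> (u \<times> w)) = \<langle>u, w\<rangle> z + \<langle>z, w\<rangle> u - 2 \<langle>u, z\<rangle> w\<close>, paired with
  \<open>v\<close>: moving \<open>u\<close> across \<open>\<beta>\<close> changes the sign because \<open>\<gamma>\<close> is alternating.\<close>
lemma gamma_cross:
  assumes "u \<in> F" "v \<in> F" "w \<in> F" "z \<in> F"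
  shows "2 * (\<gamma> u (cross z w) v + \<gamma> z (cross u w) v) =
    \<beta> u w * \<beta> z v + \<beta> z w * \<beta> u v - 2 * \<beta> u z * \<beta> w v"
proof -
  have "\<gamma> x (cross y w) v = - \<beta> (cross x v) (cross y w)" if "x \<in> F" "y \<in> F" for x y
    using that assms by (simp add: beta_cross gamma_swap(2)[of x "cross y w" v])
  then show ?thesis
    using beta_cross_cross_polarized[of u v w z] assms
    by (simp add: beta_commute[of w v] algebra_simps)
qed

lemma gamma_cross_self:
  assumes "u \<in> F" "v \<in> F" "w \<in> F"
  shows "2 * \<gamma> u (cross u w) v = \<beta> u w * \<beta> u v - \<beta> u u * \<beta> w v"
proof -
  have "\<gamma> u (cross u w) v = - \<beta> (cross u v) (cross u w)"
    using assms by (simp add: beta_cross gamma_swap(2)[of u "cross u w" v])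
  then show ?thesis using beta_cross_cross[of u v w] assms
    by (simp add: beta_commute[of w v] algebra_simps)
qed

lemma cross_cross_self_zero:
  assumes "u \<in> F" "w \<in> F" "\<beta> u w = 0" "\<beta> u u = 0"
  shows "cross u (cross u w) = 0"
  using gamma_cross_self[of u _ w] assms two by (simp add: cross_zero_iff)

lemma cross_scale:
  assumes "u \<in> F" "v \<in> F"
  shows "cross u (s c v) = s c (cross u v)"
  by (rule beta_eqI) (use assms in \<open>simp_all add: beta_left beta_cross gamma_scale\<close>)

text \<open>
  The plane complementary to \<open>a\<close> in the kernel \<open>E\<close> of \<open>a \<times> -\<close> multiplies into the line of \<open>a\<close>.
  All products of two elements of \<open>E\<close> one of which is \<open>a\<close> vanish and \<open>E\<close> is totally isotropic, so the
  cross product identity yields \<open>a \<times> (b \<times> c) = b \<times> (b \<times> c) = c \<times> (b \<times> c) = 0\<close>.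
\<close>
theorem cross_kernel_plane:
  assumes abc: "a \<in> F" "b \<in> F" "c \<in> F"
    and kernel: "{v \<in> F. \<forall>w\<in>F. \<gamma> v a w = 0} = {s p a + s q b + s r c | p q r. True}"
    and indep: "independent {a, b}" "a \<noteq> b"
  shows "\<exists>p. p \<noteq> 0 \<and> (\<forall>w\<in>F. \<gamma> b c w = p * \<beta> a w)"
proof -
  let ?E = "{v \<in> F. \<forall>w\<in>F. \<gamma> v a w = 0}"
  have nz: "a \<noteq> 0" using indep dependent_zero by blast
  obtain a' where a': "a' \<in> F" "\<beta> a' a = 1"
    using exists_prescribed_values[of "{a, b}" "\<lambda>_. 1"] indep abc by auto
  obtain b' where b': "b' \<in> F" "\<beta> b' a = 0" "\<beta> b' b = 1"
    using exists_prescribed_values[of "{a, b}" "\<lambda>e. if e = a then 0 else 1"] indep abc by auto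
  have E: "s p a + s q b + s r c \<in> ?E" for p q r unfolding kernel by blast
  have bE: "b \<in> ?E" and cE: "c \<in> ?E" using E[of 0 1 0] E[of 0 0 1] by simp_all
  have ann: "cross a v = 0 \<and> cross v a = 0" if "v \<in> ?E" for v
    using that abc gamma_swap(1)[of a v] by (auto simp: cross_zero_iff)
  have EI: "v \<in> ?E" if "v \<in> F" "cross a v = 0" for v
    using that abc gamma_swap(1)[of a v] by (auto simp: cross_zero_iff)
  have cross0: "\<gamma> u 0 v = 0" if "u \<in> F" "v \<in> F" for u v
    using gamma_scale(2)[of u v 0 0] that by simp
  \<comment> \<open>Total isotropy of \<open>E\<close>: first \<open>a\<close> itself, using that \<open>b\<close> is independent of \<open>a\<close>, then \<open>E\<close> against \<open>a\<close>,
    then \<open>E\<close> against \<open>E\<close>.\<close>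
  have aa: "\<beta> a a = 0" 
    using gamma_cross_self[of a b' b] abc b' ann[OF bE] cross0
    by (simp add: beta_commute[of a b'] beta_commute[of b b'])
  have perp: "\<beta> a v = 0" if "v \<in> ?E" for v
    using gamma_cross_self[of a a' v] abc a' ann[OF that] cross0 that aa
    by (simp add: beta_commute[of a a'])
  have EE: "\<beta> u v = 0" if "u \<in> ?E" "v \<in> ?E" for u v
  proof -
    have "2 * (\<gamma> u (cross v a) a' + \<gamma> v (cross u a) a') = - (2 * \<beta> u v * \<beta> a a')"
      using gamma_cross[of u a' a v] that abc a' perp by (simp add: beta_commute[of _ a])
    then show ?thesis
      using ann[OF that(1)] ann[OF that(2)] cross0 that a' abc two by (simp add: beta_commute[of a a'])
  qed
  define d where "d = cross b c"
  have dF: "d \<in> F" using abc by (simp add: d_def)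
  have ab: "\<beta> a b = 0" "\<beta> a c = 0" "\<beta> b c = 0" "\<beta> b b = 0" "\<beta> c c = 0" "\<beta> c b = 0"
    using perp EE bE cE by auto
  have "cross a d = 0"
  proof -
    have "\<gamma> a d w = 0" if "w \<in> F" for w
      using gamma_cross[of a w c b] abc ann[OF cE] cross0 ab two that
      by (simp add: d_def[symmetric])
    then show ?thesis using abc dF by (simp add: cross_zero_iff)
  qed
  then have "d \<in> ?E" using EI dF by blast
  then obtain p q r where d: "d = s p a + s q b + s r c" unfolding kernel by blast
  have self0: "cross u u = 0" if "u \<in> F" for u using that by (simp add: cross_zero_iff gamma_alternating)
  have bd: "cross b d = 0"
    unfolding d_def using abc ab by (intro cross_cross_self_zero)
  have ba: "cross b a = 0" using ann[OF bE] by blast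
  have ca: "cross c a = 0" using ann[OF cE] by blast
  have cb: "cross c b = s (-1) d"
    by (rule beta_eqI) (use abc gamma_swap(1)[of c b] in \<open>simp_all add: d_def beta_cross beta_left del: scale_minus_left\<close>)
  have cd: "cross c d = 0"
    using cross_cross_self_zero[of c b] cross_scale[of c d "-1"] abc ab dF by (simp add: cb)
  \<comment> \<open>Multiply \<open>d = p a + q b + r c\<close> by \<open>b\<close> and by \<open>c\<close>; only the coefficients \<open>r\<close> and \<open>q\<close> survive.\<close>
  have "s r d = cross b d"
    using abc by (subst (2) d) (simp add: cross_add cross_scale ba self0 d_def)
  then have r: "r = 0 \<or> d = 0" using bd by simp
  have "s (- q) d = cross c d"
    using abc by (subst (2) d) (simp add: cross_add cross_scale ca self0 cb)
  then have q: "q = 0 \<or> d = 0" using cd by simp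
  have "d \<noteq> 0"
  proof
    assume d0: "d = 0"
    \<comment> \<open>As \<open>b'\<close> is orthogonal to \<open>a\<close>, \<open>a \<times> b'\<close> is in \<open>E\<close> and thus annihilated by \<open>b\<close>.  In the polarised norm
      identity for \<open>a\<close>, \<open>b\<close>, \<open>a'\<close>, \<open>b'\<close> both terms on the left vanish, while the right side is \<open>2\<close>.\<close>
    have e: "cross a b' \<in> ?E"
      using cross_cross_self_zero[of a b'] abc b' aa
      by (intro EI) (auto simp: beta_commute[of a b'])
    then obtain p q r where e': "cross a b' = s p a + s q b + s r c" unfolding kernel by blast
    have "cross b (cross a b') = 0"
      using abc d0 by (subst e') (simp add: cross_add cross_scale ba self0 d_def)
    then have "\<gamma> b (cross a b') a' = 0" using a' abc b' by (simp add: cross_zero_iff)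
    moreover have "\<gamma> b (cross a b') a' = \<beta> (cross a' b) (cross a b')"
      using a' b' abc gamma_swap(2)[of b "cross a b'" a'] gamma_swap(1)[of b a' "cross a b'"]
      by (simp add: beta_cross)
    moreover have "2 * (\<beta> (cross a b) (cross a' b') + \<beta> (cross a' b) (cross a b')) = 2"
      using beta_cross_cross_polarized[of a b b' a'] a' b' abc ab
      by (simp add: beta_commute[of a a'] beta_commute[of b b'] beta_commute[of a b'])
    moreover have "\<beta> (cross a b) (cross a' b') = 0"
      using ann[OF bE] a' b' by (simp add: beta_zero)
    ultimately show False using two by simp
  qed
  then have dp: "d = s p a" using d q r by simp
  then have "p \<noteq> 0" using \<open>d \<noteq> 0\<close> by auto
  moreover have "\<gamma> b c w = p * \<beta> a w" if "w \<in> F" for w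
    using beta_cross[OF abc(2,3) that] dp abc that by (simp add: d_def[symmetric] beta_left)
  ultimately show ?thesis by blast
qed

end

section \<open>Line bundles and maps between them\<close>

lemma vector_bundleD:
  assumes "vector_bundle X r E"
  shows "vector_space (scale E)"
    and "x \<in> topspace (topol X) \<Longrightarrow> module.subspace (scale E) (fibre E x)"
    and "(U, es) \<in> frames E \<Longrightarrow> openin (topol X) U"
    and "(U, es) \<in> frames E \<Longrightarrow> length es = r"
    and "(U, es) \<in> frames E \<Longrightarrow> x \<in> U \<Longrightarrow> is_basis (scale E) (fibre E x) (map (\<lambda>e. e x) es)"
    and "(U, es) \<in> frames E \<Longrightarrow> (W, fs) \<in> frames E \<Longrightarrow> f \<in> set fs \<Longrightarrow>
      regular_coords X (scale E) (U \<inter> W) es f"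
proof -
  note * = assms[unfolded vector_bundle_def]
  have frame: "openin (topol X) U \<and> length es = r \<and>
      (\<forall>x\<in>U. is_basis (scale E) (fibre E x) (map (\<lambda>e. e x) es))" if "(U, es) \<in> frames E" for U es
    using *[THEN conjunct2, THEN conjunct2, THEN conjunct2, THEN conjunct1] that by blast
  show "vector_space (scale E)" using * by (rule conjunct1)
  show "x \<in> topspace (topol X) \<Longrightarrow> module.subspace (scale E) (fibre E x)"
    using *[THEN conjunct2, THEN conjunct1] by blast
  show "(U, es) \<in> frames E \<Longrightarrow> openin (topol X) U" "(U, es) \<in> frames E \<Longrightarrow> length es = r"
    "(U, es) \<in> frames E \<Longrightarrow> x \<in> U \<Longrightarrow> is_basis (scale E) (fibre E x) (map (\<lambda>e. e x) es)"
    using frame by blast+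
  show "(U, es) \<in> frames E \<Longrightarrow> (W, fs) \<in> frames E \<Longrightarrow> f \<in> set fs \<Longrightarrow>
      regular_coords X (scale E) (U \<inter> W) es f"
    using *[THEN conjunct2, THEN conjunct2, THEN conjunct2, THEN conjunct2] by blast
qed

lemma vector_bundle_frame:
  assumes "vector_bundle X r E" "x \<in> topspace (topol X)"
  obtains U es where "(U, es) \<in> frames E" "x \<in> U"
proof -
  have "\<Union> (fst ` frames E) = topspace (topol X)" using assms(1) by (simp add: vector_bundle_def)
  then have "x \<in> \<Union> (fst ` frames E)" using assms(2) by simp
  then show thesis using that by auto
qed

lemma line_bundle_frame:
  assumes "line_bundle X L" "x \<in> topspace (topol X)"
  obtains U e where "(U, [e]) \<in> frames L" "x \<in> U"
proof -
  obtain U es where "(U, es) \<in> frames L" "x \<in> U" by (rule vector_bundle_frame[OF assms])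
  moreover from this obtain e where "es = [e]"
    using vector_bundleD(4)[OF assms(1)] by (auto simp: length_Suc_conv)
  ultimately show thesis using that by blast
qed

lemma line_bundle_frame_single:
  assumes "line_bundle X L" "(U, es) \<in> frames L"
  obtains e where "es = [e]"
  using vector_bundleD(4)[OF assms] by (auto simp: length_Suc_conv)

lemma line_frame_fibre:
  assumes L: "line_bundle X L" and U: "(U, [e]) \<in> frames L" "x \<in> U"
  shows "e x \<noteq> 0" "fibre L x = module.span (scale L) {e x}"
    "fibre L x = range (\<lambda>c. scale L c (e x))"
proof -
  interpret vector_space "scale L" using vector_bundleD(1)[OF L] .
  have "is_basis (scale L) (fibre L x) [e x]" using vector_bundleD(5)[OF L U] by simp
  then have "independent {e x}" and sp: "span {e x} = fibre L x" by (simp_all add: is_basis_def)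
  then show "e x \<noteq> 0" using dependent_zero[of "{e x}"] by auto
  show "fibre L x = span {e x}" "fibre L x = range (\<lambda>c. scale L c (e x))"
    using sp by (simp_all add: span_singleton)
qed

lemma line_frame_in_fibre:
  assumes L: "line_bundle X L" and U: "(U, [e]) \<in> frames L" "x \<in> U"
  shows "scale L c (e x) \<in> fibre L x" "e x \<in> fibre L x"
proof -
  interpret vector_space "scale L" using vector_bundleD(1)[OF L] .
  show "scale L c (e x) \<in> fibre L x" unfolding line_frame_fibre(3)[OF assms] by (rule rangeI)
  have "scale L 1 (e x) \<in> fibre L x" unfolding line_frame_fibre(3)[OF assms] by (rule rangeI)
  then show "e x \<in> fibre L x" by simp
qed

lemma regular_coords_line:
  "regular_coords X sc U [e] s \<longleftrightarrow> (\<exists>c\<in>reg X U. \<forall>x\<in>U. s x = sc (c x) (e x))"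
  unfolding regular_coords_def
  by (auto intro: exI[of _ "\<lambda>_. _"])

lemma line_transition:
  assumes "line_bundle X L" "(U, [e]) \<in> frames L" "(W, [f]) \<in> frames L"
  obtains d where "d \<in> reg X (U \<inter> W)" "\<And>x. x \<in> U \<inter> W \<Longrightarrow> f x = scale L (d x) (e x)"
proof -
  have "regular_coords X (scale L) (U \<inter> W) [e] f"
    using vector_bundleD(6)[OF assms] by simp
  then show thesis using that unfolding regular_coords_line by blast
qed

lemma regular_section_line_coord:
  assumes "regular_section X L U s" "(W, [e]) \<in> frames L"
  obtains c where "c \<in> reg X (U \<inter> W)" "\<And>x. x \<in> U \<inter> W \<Longrightarrow> s x = scale L (c x) (e x)"
proof -
  have "regular_coords X (scale L) (U \<inter> W) [e] s"
    using assms unfolding regular_section_def by blast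
  then show thesis using that unfolding regular_coords_line by blast
qed

lemma regular_section_frame:
  assumes E: "vector_bundle X r E" and "(U, es) \<in> frames E" "e \<in> set es"
  shows "regular_section X E U e"
  unfolding regular_section_def
proof (intro conjI ballI, safe)
  show "openin (topol X) U" using vector_bundleD(3)[OF E assms(2)] .
  interpret vector_space "scale E" using vector_bundleD(1)[OF E] .
  show "e x \<in> fibre E x" if "x \<in> U" for x
  proof -
    have "span (set (map (\<lambda>e. e x) es)) = fibre E x"
      using vector_bundleD(5)[OF E assms(2) that] by (simp add: is_basis_def)
    moreover have "e x \<in> span (set (map (\<lambda>e. e x) es))" using assms(3) by (intro span_base) auto
    ultimately show ?thesis by simp
  qed
  show "regular_coords X (scale E) (U \<inter> W) fs e" if "(W, fs) \<in> frames E" for W fs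
    using vector_bundleD(6)[OF E that assms(2,3)] by (simp add: Int_commute)
qed

lemma regular_section_restrict:
  assumes X: "sheaf_of_functions X" and E: "vector_bundle X r E"
    and s: "regular_section X E U s" and N: "openin (topol X) N" "N \<subseteq> U"
  shows "regular_section X E N s"
  unfolding regular_section_def
proof (intro conjI ballI, safe)
  have U: "openin (topol X) U" using s by (simp add: regular_section_def)
  show "openin (topol X) N" by fact
  show "s x \<in> fibre E x" if "x \<in> N" for x using s N that by (auto simp: regular_section_def)
  fix W es assume W: "(W, es) \<in> frames E"
  have oW: "openin (topol X) W" using vector_bundleD(3)[OF E W] .
  have "regular_coords X (scale E) (U \<inter> W) es s"
    using s W unfolding regular_section_def by blast
  then obtain c where c: "\<And>i. i < length es \<Longrightarrow> c i \<in> reg X (U \<inter> W)"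
    "\<And>x. x \<in> U \<inter> W \<Longrightarrow> s x = (\<Sum>i<length es. scale E (c i x) ((es ! i) x))"
    unfolding regular_coords_def by blast
  have "c i \<in> reg X (N \<inter> W)" if "i < length es" for i
    by (rule reg_restrict[OF X _ _ _ c(1)[OF that]]) (use U N oW in auto)
  then show "regular_coords X (scale E) (N \<inter> W) es s"
    unfolding regular_coords_def using c(2) N by (intro exI[of _ c]) auto
qed

lemma tensor_bundle_simps [simp]:
  "scale (E \<otimes>\<^sub>B F) = fun_scale"
  "fibre (E \<otimes>\<^sub>B F) x = tensor_space (scale E) (scale F) (fibre E x) (fibre F x)"
  by (simp_all add: tensor_bundle_def)

lemma tensor_bundle_line_frame:
  assumes "(U, [e]) \<in> frames E" "(W, [f]) \<in> frames F"
  shows "(U \<inter> W, [\<lambda>x. pure_tensor (scale E) (scale F) (e x) (f x)]) \<in> frames (E \<otimes>\<^sub>B F)"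
  using assms unfolding tensor_bundle_def by force

lemma tensor_bundle_line_framesE:
  assumes E: "line_bundle X E" and F: "line_bundle X F" and "(N, gs) \<in> frames (E \<otimes>\<^sub>B F)"
  obtains U e W f where "(U, [e]) \<in> frames E" "(W, [f]) \<in> frames F" "N = U \<inter> W"
    "gs = [\<lambda>x. pure_tensor (scale E) (scale F) (e x) (f x)]"
proof -
  obtain U es W fs where *: "(U, es) \<in> frames E" "(W, fs) \<in> frames F" "N = U \<inter> W"
    "gs = [\<lambda>x. pure_tensor (scale E) (scale F) (e x) (f x). e \<leftarrow> es, f \<leftarrow> fs]"
    using assms(3) unfolding tensor_bundle_def by auto
  obtain e where e: "es = [e]" by (rule line_bundle_frame_single[OF E *(1)])
  obtain f where f: "fs = [f]" by (rule line_bundle_frame_single[OF F *(2)])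
  show thesis using that * by (simp add: e f)
qed

lemma line_bundle_tensor:
  assumes X: "prevariety X" and E: "line_bundle X E" and F: "line_bundle X F"
  shows "line_bundle X (E \<otimes>\<^sub>B F)"
proof -
  interpret tensor_factors "scale E" "scale F"
    by (intro tensor_factors.intro vector_bundleD(1)[OF E] vector_bundleD(1)[OF F])
  have fr: "openin (topol X) N \<and> length gs = 1 \<and>
      (\<forall>x\<in>N. is_basis fun_scale (tensor_space (scale E) (scale F) (fibre E x) (fibre F x)) (map (\<lambda>e. e x) gs))"
    if N: "(N, gs) \<in> frames (E \<otimes>\<^sub>B F)" for N gs
  proof -
    obtain U e W f where *: "(U, [e]) \<in> frames E" "(W, [f]) \<in> frames F" "N = U \<inter> W"
      "gs = [\<lambda>x. pure_tensor (scale E) (scale F) (e x) (f x)]"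
      by (rule tensor_bundle_line_framesE[OF E F N])
    have "is_basis fun_scale (tensor_space (scale E) (scale F) (fibre E x) (fibre F x)) [pure_tensor (scale E) (scale F) (e x) (f x)]"
      if "x \<in> N" for x
    proof -
      have x: "x \<in> U" "x \<in> W" using that * by auto
      note e = line_frame_fibre(1,2)[OF E *(1) x(1)] and f = line_frame_fibre(1,2)[OF F *(2) x(2)]
      have "pure_tensor (scale E) (scale F) (e x) (f x) \<noteq> 0" using e f by (simp add: pure_tensor_eq_0_iff)
      moreover have "t.span {pure_tensor (scale E) (scale F) (e x) (f x)} = tensor_space (scale E) (scale F) (fibre E x) (fibre F x)"
      proof
        show "t.span {pure_tensor (scale E) (scale F) (e x) (f x)} \<subseteq> tensor_space (scale E) (scale F) (fibre E x) (fibre F x)"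
          using line_frame_in_fibre(2)[OF E *(1) x(1)] line_frame_in_fibre(2)[OF F *(2) x(2)]
          by (intro t.span_minimal tensor_space_subspace) (simp add: pure_tensor_in_space)
        show "tensor_space (scale E) (scale F) (fibre E x) (fibre F x) \<subseteq> t.span {pure_tensor (scale E) (scale F) (e x) (f x)}"
          using tensor_space_line[of _ "e x" "f x"] e f by (auto simp: t.span_singleton)
      qed
      ultimately show ?thesis by (simp add: is_basis_def)
    qed
    then show ?thesis
      using vector_bundleD(3)[OF E *(1)] vector_bundleD(3)[OF F *(2)] by (auto simp: *)
  qed
  have trans: "regular_coords X fun_scale (N \<inter> N') gs g"
    if N: "(N, gs) \<in> frames (E \<otimes>\<^sub>B F)" "(N', gs') \<in> frames (E \<otimes>\<^sub>B F)" "g \<in> set gs'" for N gs N' gs' g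
  proof -
    obtain U e W f where *: "(U, [e]) \<in> frames E" "(W, [f]) \<in> frames F" "N = U \<inter> W"
      "gs = [\<lambda>x. pure_tensor (scale E) (scale F) (e x) (f x)]"
      by (rule tensor_bundle_line_framesE[OF E F N(1)])
    obtain U' e' W' f' where U': "(U', [e']) \<in> frames E" "(W', [f']) \<in> frames F" "N' = U' \<inter> W'"
      "gs' = [\<lambda>x. pure_tensor (scale E) (scale F) (e' x) (f' x)]"
      by (rule tensor_bundle_line_framesE[OF E F N(2)])
    obtain c where c: "c \<in> reg X (U \<inter> U')" "\<And>x. x \<in> U \<inter> U' \<Longrightarrow> e' x = scale E (c x) (e x)"
      by (rule line_transition[OF E *(1) U'(1)]) (rule that)
    obtain d where d: "d \<in> reg X (W \<inter> W')" "\<And>x. x \<in> W \<inter> W' \<Longrightarrow> f' x = scale F (d x) (f x)"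
      by (rule line_transition[OF F *(2) U'(2)]) (rule that)
    note opens = vector_bundleD(3)[OF E *(1)] vector_bundleD(3)[OF E U'(1)]
      vector_bundleD(3)[OF F *(2)] vector_bundleD(3)[OF F U'(2)]
    have o: "openin (topol X) (N \<inter> N')" using opens by (auto simp: * U')
    have "c \<in> reg X (N \<inter> N')"
      by (rule reg_restrict[OF prevariety_sheaf[OF X] _ o _ c(1)]) (use opens in \<open>auto simp: * U'\<close>)
    moreover have "d \<in> reg X (N \<inter> N')"
      by (rule reg_restrict[OF prevariety_sheaf[OF X] _ o _ d(1)]) (use opens in \<open>auto simp: * U'\<close>)
    ultimately have "(\<lambda>x. d x * c x) \<in> reg X (N \<inter> N')" by (intro reg_mult[OF X o])
    then show ?thesis
      using N(3) c(2) d(2) unfolding *(3,4) U'(3,4)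
      by (auto simp: regular_coords_line pure_tensor_scale_left pure_tensor_scale_right
          intro!: bexI[of _ "\<lambda>x. d x * c x"])
  qed
  have cover: "\<Union> (fst ` frames (E \<otimes>\<^sub>B F)) = topspace (topol X)"
  proof
    show "\<Union> (fst ` frames (E \<otimes>\<^sub>B F)) \<subseteq> topspace (topol X)"
      using fr openin_subset by fastforce
    show "topspace (topol X) \<subseteq> \<Union> (fst ` frames (E \<otimes>\<^sub>B F))"
    proof
      fix x assume x: "x \<in> topspace (topol X)"
      obtain U e where U: "(U, [e]) \<in> frames E" "x \<in> U" by (rule line_bundle_frame[OF E x])
      obtain W f where W: "(W, [f]) \<in> frames F" "x \<in> W" by (rule line_bundle_frame[OF F x])
      show "x \<in> \<Union> (fst ` frames (E \<otimes>\<^sub>B F))"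
        using tensor_bundle_line_frame[OF U(1) W(1)] U(2) W(2) by force
    qed
  qed
  show ?thesis
    unfolding vector_bundle_def tensor_bundle_simps
  proof (intro conjI)
    show "\<forall>(N, gs)\<in>frames (E \<otimes>\<^sub>B F). openin (topol X) N \<and> length gs = 1 \<and>
      (\<forall>x\<in>N. is_basis fun_scale (tensor_space (scale E) (scale F) (fibre E x) (fibre F x)) (map (\<lambda>e. e x) gs))"
      using fr by blast
    show "\<forall>(N, gs)\<in>frames (E \<otimes>\<^sub>B F). \<forall>(N', gs')\<in>frames (E \<otimes>\<^sub>B F). \<forall>g\<in>set gs'.
      regular_coords X fun_scale (N \<inter> N') gs g"
      using trans by blast
  qed (use cover tensor_space_subspace vector_space_fun_scale in auto)
qed

text \<open>In suitable frames near \<open>x\<close>, the map is multiplication by the invertible regular function \<open>h\<close>.\<close>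
definition multiplier_at ::
  "('k::field, 'x) fun_space \<Rightarrow> ('k, 'x, 'v::ab_group_add) vbundle \<Rightarrow>
   ('k, 'x, 'w::ab_group_add) vbundle \<Rightarrow> ('x \<Rightarrow> 'v \<Rightarrow> 'w) \<Rightarrow> 'x \<Rightarrow> ('x \<Rightarrow> 'k) \<Rightarrow> bool" where
  "multiplier_at X A B \<phi> x h \<longleftrightarrow>
     (\<exists>U e W f N. (U, [e]) \<in> frames A \<and> (W, [f]) \<in> frames B \<and> openin (topol X) N \<and> x \<in> N \<and>
        N \<subseteq> U \<inter> W \<and> h \<in> reg X N \<and>
        (\<forall>y\<in>N. h y \<noteq> 0 \<and> \<phi> y (e y) = scale B (h y) (f y)))"

lemma multiplier_atI:
  assumes "(U, [e]) \<in> frames A" "(W, [f]) \<in> frames B" "openin (topol X) N" "x \<in> N"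
    "N \<subseteq> U \<inter> W" "h \<in> reg X N"
    "\<And>y. y \<in> N \<Longrightarrow> h y \<noteq> 0 \<and> \<phi> y (e y) = scale B (h y) (f y)"
  shows "multiplier_at X A B \<phi> x h"
  using assms unfolding multiplier_at_def by blast

lemma multiplier_atE:
  assumes "multiplier_at X A B \<phi> x h"
  obtains U e W f N where "(U, [e]) \<in> frames A" "(W, [f]) \<in> frames B" "openin (topol X) N" "x \<in> N"
    "N \<subseteq> U \<inter> W" "h \<in> reg X N" "\<And>y. y \<in> N \<Longrightarrow> h y \<noteq> 0"
    "\<And>y. y \<in> N \<Longrightarrow> \<phi> y (e y) = scale B (h y) (f y)"
  using assms unfolding multiplier_at_def by blast

text \<open>
  Regularity of the image of a section may be tested near each point.  There its coordinate in any frame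
  of \<open>B\<close> is the product of the coordinate of the section, the multiplier and a transition function.
\<close>
lemma line_bundle_map_local:
  assumes X: "prevariety X" and A: "line_bundle X A" and B: "line_bundle X B"
    and lin: "\<And>x. x \<in> topspace (topol X) \<Longrightarrow>
      linear_on (scale A) (scale B) (fibre A x) (fibre B x) (\<phi> x)"
    and loc: "\<And>x. x \<in> topspace (topol X) \<Longrightarrow> \<exists>h. multiplier_at X A B \<phi> x h"
  shows "bundle_map X A B \<phi>"
  unfolding bundle_map_def
proof (intro conjI ballI allI impI)
  fix U0 s assume s: "regular_section X A U0 s"
  have U0: "openin (topol X) U0" and sA: "\<And>x. x \<in> U0 \<Longrightarrow> s x \<in> fibre A x"
    using s by (auto simp: regular_section_def)
  have top: "x \<in> topspace (topol X)" if "x \<in> U0" for x using U0 that openin_subset by blast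
  have phiB: "\<phi> x (s x) \<in> fibre B x" if "x \<in> U0" for x
    using lin[OF top[OF that]] sA[OF that] by (auto simp: linear_on_def)
  interpret vb: vector_space "scale B" using vector_bundleD(1)[OF B] .
  show "regular_section X B U0 (\<lambda>x. \<phi> x (s x))"
    unfolding regular_section_def
  proof (intro conjI ballI, safe)
    fix W' gs assume W': "(W', gs) \<in> frames B"
    obtain g where g: "gs = [g]" by (rule line_bundle_frame_single[OF B W'])
    note fg = W'[unfolded g]
    have oW': "openin (topol X) W'" using vector_bundleD(3)[OF B W'] .
    have "\<forall>x\<in>U0 \<inter> W'. \<exists>c. \<phi> x (s x) = scale B c (g x)"
    proof
      fix x assume x: "x \<in> U0 \<inter> W'"
      then have "\<phi> x (s x) \<in> range (\<lambda>c. scale B c (g x))"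
        using phiB[of x] line_frame_fibre(3)[OF B fg, of x] by simp
      then show "\<exists>c. \<phi> x (s x) = scale B c (g x)" by blast
    qed
    then obtain c where c: "\<And>x. x \<in> U0 \<inter> W' \<Longrightarrow> \<phi> x (s x) = scale B (c x) (g x)" by metis
    have "c \<in> reg X (U0 \<inter> W')"
    proof (rule reg_glue[OF prevariety_sheaf[OF X]])
      show "openin (topol X) (U0 \<inter> W')" using U0 oW' by auto
      fix x assume x: "x \<in> U0 \<inter> W'"
      then obtain h where "multiplier_at X A B \<phi> x h" using loc[OF top, of x] by auto
      then obtain U e W f N where h: "(U, [e]) \<in> frames A" "(W, [f]) \<in> frames B"
        "openin (topol X) N" "x \<in> N" "N \<subseteq> U \<inter> W" "h \<in> reg X N"
        "\<And>y. y \<in> N \<Longrightarrow> \<phi> y (e y) = scale B (h y) (f y)"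
        by (rule multiplier_atE) (rule that)
      obtain r where r: "r \<in> reg X (U0 \<inter> U)" "\<And>x. x \<in> U0 \<inter> U \<Longrightarrow> s x = scale A (r x) (e x)"
        by (rule regular_section_line_coord[OF s h(1)]) (rule that)
      obtain d where d: "d \<in> reg X (W' \<inter> W)" "\<And>x. x \<in> W' \<inter> W \<Longrightarrow> f x = scale B (d x) (g x)"
        by (rule line_transition[OF B fg h(2)]) (rule that)
      define N' where "N' = N \<inter> U0 \<inter> W'"
      note opens = vector_bundleD(3)[OF A h(1)] vector_bundleD(3)[OF B h(2)] U0 oW' h(3)
      have oN': "openin (topol X) N'" using opens by (auto simp: N'_def)
      have "r \<in> reg X N'" "h \<in> reg X N'" "d \<in> reg X N'"
        by (rule reg_restrict[OF prevariety_sheaf[OF X] _ oN' _ r(1)]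
            reg_restrict[OF prevariety_sheaf[OF X] _ oN' _ h(6)]
            reg_restrict[OF prevariety_sheaf[OF X] _ oN' _ d(1)];
            use opens h(5) in \<open>auto simp: N'_def\<close>)+
      then have "(\<lambda>y. r y * h y * d y) \<in> reg X N'" by (intro reg_mult[OF X oN'])
      moreover have "c y = r y * h y * d y" if y: "y \<in> N'" for y
      proof -
        have y': "y \<in> U0" "y \<in> W'" "y \<in> U" "y \<in> W" "y \<in> N" using y h(5) by (auto simp: N'_def)
        have "scale B (c y) (g y) = \<phi> y (scale A (r y) (e y))" using c r y' by force
        also have "\<dots> = scale B (r y) (\<phi> y (e y))"
          using lin[OF top[OF y'(1)]] line_frame_in_fibre(2)[OF A h(1) y'(3)] by (simp add: linear_on_def)
        also have "\<dots> = scale B (r y * h y * d y) (g y)" using h(7) d(2) y' by (simp add: mult.assoc)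
        finally show ?thesis using line_frame_fibre(1)[OF B fg y'(2)] by simp
      qed
      ultimately show "\<exists>W g. openin (topol X) W \<and> x \<in> W \<and> W \<subseteq> U0 \<inter> W' \<and> g \<in> reg X W \<and>
          (\<forall>y\<in>W. c y = g y)"
        using oN' x h(4) by (intro exI[of _ N'] exI conjI) (auto simp: N'_def)
    qed
    then show "regular_coords X (scale B) (U0 \<inter> W') gs (\<lambda>x. \<phi> x (s x))"
      unfolding g regular_coords_line using c by blast
  qed (use U0 phiB in auto)
qed (use lin in auto)

text \<open>The inverse map has the multiplier \<open>1 / h\<close>, so it satisfies the same criterion.\<close>
lemma line_bundle_iso_local:
  assumes X: "prevariety X" and A: "line_bundle X A" and B: "line_bundle X B"
    and lin: "\<And>x. x \<in> topspace (topol X) \<Longrightarrow>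
      linear_on (scale A) (scale B) (fibre A x) (fibre B x) (\<phi> x)"
    and loc: "\<And>x. x \<in> topspace (topol X) \<Longrightarrow> \<exists>h. multiplier_at X A B \<phi> x h"
  shows "bundle_iso X A B \<phi>"
proof -
  interpret va: vector_space "scale A" using vector_bundleD(1)[OF A] .
  interpret vb: vector_space "scale B" using vector_bundleD(1)[OF B] .
  define \<psi> where "\<psi> x = inv_into (fibre A x) (\<phi> x)" for x
  have phi_coord: "\<phi> y (scale A a (e y)) = scale B (a * c) b"
    if "(U, [e]) \<in> frames A" "y \<in> U" "\<phi> y (e y) = scale B c b" for U e y a b c
  proof -
    have "y \<in> topspace (topol X)" using vector_bundleD(3)[OF A that(1)] that(2) openin_subset by blast
    then show ?thesis
      using lin line_frame_in_fibre(2)[OF A that(1,2)] that(3) by (simp add: linear_on_def)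
  qed
  have bij: "bij_betw (\<phi> x) (fibre A x) (fibre B x)" if x: "x \<in> topspace (topol X)" for x
  proof -
    obtain h where "multiplier_at X A B \<phi> x h" using loc[OF x] by auto
    then obtain U e W f N where h: "(U, [e]) \<in> frames A" "(W, [f]) \<in> frames B" "x \<in> N"
        "N \<subseteq> U \<inter> W" "\<And>y. y \<in> N \<Longrightarrow> h y \<noteq> 0" "\<And>y. y \<in> N \<Longrightarrow> \<phi> y (e y) = scale B (h y) (f y)"
      by (rule multiplier_atE) (rule that)
    have xU: "x \<in> U" "x \<in> W" using h by auto
    have \<phi>: "\<phi> x (scale A a (e x)) = scale B (a * h x) (f x)" for a
      using phi_coord[OF h(1) xU(1) h(6)[OF h(3)]] .
    have "inj_on (\<phi> x) (fibre A x)"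
      unfolding line_frame_fibre(3)[OF A h(1) xU(1)]
      using h(5)[OF h(3)] line_frame_fibre(1)[OF B h(2) xU(2)] by (auto simp: inj_on_def \<phi>)
    moreover have "\<phi> x ` fibre A x = fibre B x"
      unfolding line_frame_fibre(3)[OF A h(1) xU(1)] line_frame_fibre(3)[OF B h(2) xU(2)]
    proof (intro equalityI subsetI)
      fix b assume "b \<in> range (\<lambda>c. scale B c (f x))"
      then obtain c where "b = scale B c (f x)" by auto
      then have "b = \<phi> x (scale A (c / h x) (e x))" using h(5)[OF h(3)] by (simp add: \<phi>)
      then show "b \<in> \<phi> x ` range (\<lambda>c. scale A c (e x))" by auto
    qed (auto simp: \<phi>)
    ultimately show ?thesis by (simp add: bij_betw_def)
  qed
  have inv: "\<psi> x (\<phi> x v) = v" if "x \<in> topspace (topol X)" "v \<in> fibre A x" for x v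
    using bij[OF that(1)] that(2) by (simp add: \<psi>_def bij_betw_def)
  have inv': "\<phi> x (\<psi> x w) = w" "\<psi> x w \<in> fibre A x" if "x \<in> topspace (topol X)" "w \<in> fibre B x" for x w
    using bij[OF that(1)] that(2) by (auto simp: \<psi>_def bij_betw_def f_inv_into_f inv_into_into)
  have "bundle_map X B A \<psi>"
  proof (rule line_bundle_map_local[OF X B A])
    fix x assume x: "x \<in> topspace (topol X)"
    note subA = vector_bundleD(2)[OF A x]
    have eqI: "\<psi> x w = v" if "v \<in> fibre A x" "\<phi> x v = w" for v w using inv[OF x that(1)] that(2) by simp
    show "linear_on (scale B) (scale A) (fibre B x) (fibre A x) (\<psi> x)"
      unfolding linear_on_def
      using lin[OF x] inv'[OF x]
      by (auto intro!: eqI va.subspace_add[OF subA] va.subspace_scale[OF subA] simp: linear_on_def)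
    obtain h where "multiplier_at X A B \<phi> x h" using loc[OF x] by auto
    then obtain U e W f N where h: "(U, [e]) \<in> frames A" "(W, [f]) \<in> frames B" "openin (topol X) N" "x \<in> N"
        "N \<subseteq> U \<inter> W" "h \<in> reg X N" "\<And>y. y \<in> N \<Longrightarrow> h y \<noteq> 0"
        "\<And>y. y \<in> N \<Longrightarrow> \<phi> y (e y) = scale B (h y) (f y)"
      by (rule multiplier_atE) (rule that)
    have "\<psi> y (f y) = scale A (1 / h y) (e y)" if y: "y \<in> N" for y
    proof -
      have y': "y \<in> U" "y \<in> topspace (topol X)" using y h(5) h(3) openin_subset by blast+
      have "\<phi> y (scale A (1 / h y) (e y)) = f y"
        using phi_coord[OF h(1) y'(1) h(8)[OF y], of "1 / h y"] h(7)[OF y] by simp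
      then show ?thesis using inv[OF y'(2) line_frame_in_fibre(1)[OF A h(1) y'(1)]] by metis
    qed
    moreover have "(\<lambda>y. 1 / h y) \<in> reg X N" by (rule reg_inverse[OF X h(3,6,7)])
    ultimately show "\<exists>k. multiplier_at X B A \<psi> x k"
      unfolding multiplier_at_def using h
      by (intro exI[of _ "\<lambda>y. 1 / h y"] exI[of _ W] exI[of _ f] exI[of _ U] exI[of _ e] exI[of _ N]) auto
  qed
  moreover have "bundle_map X A B \<phi>" by (rule line_bundle_map_local[OF X A B lin loc])
  ultimately show ?thesis unfolding bundle_iso_def using inv inv' by blast
qed

section \<open>The contraction of the second and third line\<close>

lemma two_neq_zero_of_CHAR:
  assumes "CHAR('k::field) \<noteq> 2"
  shows "(2::'k) \<noteq> 0"
proof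
  assume "(2::'k) = 0"
  then have "of_nat 2 = (0::'k)" by simp
  then have "CHAR('k) dvd 2" by (simp only: of_nat_eq_0_iff_char_dvd)
  then have "CHAR('k) = 1" using assms two_is_prime_nat by (auto simp: prime_nat_iff)
  then show False using CHAR_not_1[where 'a='k] by simp
qed

lemma coord_scale:
  assumes "vector_space s" "e \<noteq> 0"
  shows "coord s e (s c e) = c"
proof -
  interpret vector_space s by fact
  show ?thesis unfolding coord_def using assms(2) by (intro the_equality) auto
qed

text \<open>A vector in two different summands has two decompositions, each with a single entry, which
  must coincide.\<close>
lemma direct_sum_fibres_independent:
  assumes sum: "is_direct_sum X I L V" and I: "finite I" "i \<in> I" "j \<in> I" "i \<noteq> j"
    and x: "x \<in> topspace (topol X)" and zero: "\<And>k. k \<in> I \<Longrightarrow> 0 \<in> fibre (L k) x"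
    and v: "v \<in> fibre (L i) x" "v \<in> fibre (L j) x" "v \<in> fibre V x"
  shows "v = 0"
proof -
  define l where "l j = (\<lambda>k\<in>I. if k = j then v else 0)" for j
  have l: "l j \<in> (\<Pi>\<^sub>E k\<in>I. fibre (L k) x) \<and> v = sum (l j) I" if "j \<in> I" "v \<in> fibre (L j) x" for j
    using that zero I(1) by (auto simp: l_def)
  have "\<exists>!l. l \<in> (\<Pi>\<^sub>E i\<in>I. fibre (L i) x) \<and> v = (\<Sum>i\<in>I. l i)"
    using sum x v(3) unfolding is_direct_sum_def by blast
  then have "l i = l j" using l[OF I(2) v(1)] l[OF I(3) v(2)] by blast
  then have "l i i = l j i" by simp
  then show ?thesis using I by (simp add: l_def)
qed

text \<open>Elements of the fibre of \<open>V\<^sup>* \<otimes> M\<^sup>\<otimes>\<^sup>3\<close> are extended by zero outside the fibre of \<open>V\<close>; this keeps the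
  dependence on the other arguments linear.\<close>
lemma bilinear_extended_by_zero:
  assumes s3: "vector_space s3" and "\<And>w. w \<in> F \<Longrightarrow> linear_on s1 s3 G H (\<lambda>v. B v w)"
  shows "linear_on s1 (\<lambda>c f w. s3 c (f w)) G UNIV (\<lambda>v w. if w \<in> F then B v w else 0)"
proof -
  interpret vector_space s3 by fact
  show ?thesis using assms(2) by (auto simp: linear_on_def fun_eq_iff)
qed

locale kernel_splitting =
  fixes X :: "('k::field, 'x) fun_space"
    and V :: "('k, 'x, 'v::ab_group_add) vbundle"
    and M :: "('k, 'x, 'm::ab_group_add) vbundle"
    and r :: nat and I :: "nat set" and L :: "nat \<Rightarrow> ('k, 'x, 'v) vbundle"
    and \<gamma> :: "'x \<Rightarrow> 'v \<Rightarrow> 'v \<Rightarrow> 'v \<Rightarrow> ('k, ('k, 'm, 'm) tensor, 'm) tensor"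
    and \<beta> :: "'x \<Rightarrow> 'v \<Rightarrow> 'v \<Rightarrow> ('k, 'm, 'm) tensor"
  assumes char: "CHAR('k) \<noteq> 2"
    and X: "prevariety X"
    and V: "vector_bundle X r V"
    and M: "line_bundle X M"
    and \<gamma>: "alternating_form X V (tensor_cube M) \<gamma>"
    and \<beta>: "symmetric_bilinear_form X V (tensor_square M) \<beta>"
    and nondegenerate: "nondegenerate_form X V \<beta>"
    and compatible: "locally_compatible X V M \<gamma> \<beta>"
    and I: "finite I" "{1, 2, 3} \<subseteq> I"
    and L: "\<And>i. i \<in> I \<Longrightarrow> line_bundle X (L i)"
    and splitting: "is_direct_sum X I L V"
    and kernel: "\<And>x. x \<in> topspace (topol X) \<Longrightarrow>
      {a + b + c | a b c. a \<in> fibre (L 1) x \<and> b \<in> fibre (L 2) x \<and> c \<in> fibre (L 3) x}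
        = kernel_fibre V \<gamma> (L 1) x"
begin

lemma subbundle_L: "i \<in> I \<Longrightarrow> subbundle X (L i) V"
  using splitting by (simp add: is_direct_sum_def)

lemma scale_L: "i \<in> I \<Longrightarrow> scale (L i) = scale V"
  using subbundle_L by (simp add: subbundle_def)

lemma fibre_L_subset: "i \<in> I \<Longrightarrow> x \<in> topspace (topol X) \<Longrightarrow> fibre (L i) x \<subseteq> fibre V x"
  using subbundle_L unfolding subbundle_def bundle_map_def linear_on_def by blast

lemma L_section: "i \<in> I \<Longrightarrow> regular_section X (L i) U s \<Longrightarrow> regular_section X V U s"
  using subbundle_L unfolding subbundle_def bundle_map_def by blast

sublocale v: vector_space "scale V" using vector_bundleD(1)[OF V] .
sublocale m: vector_space "scale M" using vector_bundleD(1)[OF M] .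
sublocale mm: tensor_factors "scale M" "scale M" ..
sublocale mmm: tensor_factors fun_scale "scale M"
  by (intro tensor_factors.intro vector_space_fun_scale) unfold_locales
sublocale vm: tensor_factors "scale V" "scale M" ..
sublocale vv: tensor_factors "scale V" "scale V" ..

lemma line_frame_L:
  assumes "i \<in> I" "(U, [e]) \<in> frames (L i)" "x \<in> U"
  shows "e x \<noteq> 0" "fibre (L i) x = range (\<lambda>c. scale V c (e x))" "e x \<in> fibre V x"
proof -
  have "x \<in> topspace (topol X)"
    using vector_bundleD(3)[OF L[OF assms(1)] assms(2)] assms(3) openin_subset by blast
  then show "e x \<noteq> 0" "fibre (L i) x = range (\<lambda>c. scale V c (e x))" "e x \<in> fibre V x"
    using line_frame_fibre(1,3)[OF L[OF assms(1)] assms(2,3)] fibre_L_subset[OF assms(1)]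
      line_frame_in_fibre(2)[OF L[OF assms(1)] assms(2,3)] scale_L[OF assms(1)] by auto
qed

text \<open>
  The theorem on the cross product, freed from the trivialisation \<open>m\<^sub>0\<close> of \<open>M\<close> used to state
  compatibility.  Writing \<open>\<gamma>\<close> and \<open>\<beta>\<close> through their coordinates, the scalar equation becomes
  \<open>\<gamma>(e\<^sub>2, e\<^sub>3, w) = p \<beta>(e\<^sub>1, w) \<otimes> m\<^sub>0\<close>; replacing \<open>m\<^sub>0\<close> by the given frame only rescales \<open>p\<close>.
\<close>
lemma contraction_on_fibre:
  assumes U1: "(U1, [e1]) \<in> frames (L 1)" "x \<in> U1" and U2: "(U2, [e2]) \<in> frames (L 2)" "x \<in> U2"
    and U3: "(U3, [e3]) \<in> frames (L 3)" "x \<in> U3" and UM: "(UM, [m]) \<in> frames M" "x \<in> UM"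
  shows "\<exists>p. p \<noteq> 0 \<and> (\<forall>w\<in>fibre V x. \<gamma> x (e2 x) (e3 x) w =
    fun_scale p (pure_tensor fun_scale (scale M) (\<beta> x (e1 x) w) (m x)))"
proof -
  define F where "F = fibre V x"
  have x: "x \<in> topspace (topol X)" using vector_bundleD(3)[OF M UM(1)] UM(2) openin_subset by blast
  have i: "1 \<in> I" "2 \<in> I" "3 \<in> I" using I by auto
  note a = line_frame_L[OF i(1) U1] and b = line_frame_L[OF i(2) U2] and c = line_frame_L[OF i(3) U3]
  obtain U m0 where m0: "x \<in> U" "regular_section X M U m0" "m0 x \<noteq> 0"
    and comp: "compatible (scale V) F
      (\<lambda>u v w. coord fun_scale (mmm.pt (mm.pt (m0 x) (m0 x)) (m0 x)) (\<gamma> x u v w))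
      (\<lambda>u v. coord fun_scale (mm.pt (m0 x) (m0 x)) (\<beta> x u v))"
    using compatible x unfolding locally_compatible_def Let_def tensor_bundle_simps F_def by blast
  define m2 where "m2 = mm.pt (m0 x) (m0 x)"
  define m3 where "m3 = mmm.pt m2 (m0 x)"
  define g where "g u v w = coord fun_scale m3 (\<gamma> x u v w)" for u v w
  define b' where "b' u v = coord fun_scale m2 (\<beta> x u v)" for u v
  have comp': "compatible (scale V) F g b'"
    using comp by (simp add: g_def[abs_def] b'_def[abs_def] m2_def m3_def)
  have m2: "m2 \<noteq> 0" using m0(3) by (simp add: m2_def mm.pure_tensor_eq_0_iff)
  have m3: "m3 \<noteq> 0" using m0(3) m2 by (simp add: m3_def mmm.pure_tensor_eq_0_iff)
  note mx = line_frame_fibre(1,3)[OF M UM]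
  have "m0 x \<in> fibre M x" using m0 by (simp add: regular_section_def)
  then obtain t where t: "m0 x = scale M t (m x)" using mx by auto
  have t0: "t \<noteq> 0" using t m0(3) by auto
  have fM: "fibre M x = m.span {m0 x}"
    unfolding mx m.span_singleton
  proof (intro equalityI subsetI)
    fix y assume "y \<in> range (\<lambda>c. scale M c (m x))"
    then obtain k where "y = scale M k (m x)" by auto
    then have "y = scale M (k / t) (m0 x)" using t0 by (simp add: t)
    then show "y \<in> range (\<lambda>k. scale M k (m0 x))" by auto
  qed (auto simp: t)
  have beta: "\<beta> x u v = fun_scale (b' u v) m2" if "u \<in> F" "v \<in> F" for u v
  proof -
    have "\<beta> x u v \<in> fibre (tensor_square M) x"
      using \<beta> x that by (auto simp: symmetric_bilinear_form_def symmetric_on_def linear_on_def F_def)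
    then obtain k where "\<beta> x u v = fun_scale k m2"
      using mm.tensor_space_line[of _ "m0 x" "m0 x"] by (auto simp: fM m2_def)
    then show ?thesis by (simp add: b'_def coord_scale[OF vector_space_fun_scale m2])
  qed
  have gamma: "\<gamma> x u v w = fun_scale (g u v w) m3" if "u \<in> F" "v \<in> F" "w \<in> F" for u v w
  proof -
    have "\<gamma> x u v w \<in> fibre (tensor_cube M) x"
      using \<gamma> x that by (auto simp: alternating_form_def alternating_on_def linear_on_def F_def)
    moreover have "tensor_space (scale M) (scale M) (m.span {m0 x}) (m.span {m0 x}) \<subseteq> mm.t.span {m2}"
      using mm.tensor_space_line[of _ "m0 x" "m0 x"] by (auto simp: mm.t.span_singleton m2_def)
    ultimately have "\<gamma> x u v w \<in> tensor_space fun_scale (scale M) (mm.t.span {m2}) (m.span {m0 x})"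
      unfolding tensor_bundle_simps fM using mmm.tensor_space_mono by blast
    then obtain k where "\<gamma> x u v w = fun_scale k m3"
      using mmm.tensor_space_line[of _ m2 "m0 x"] by (auto simp: m3_def)
    then show ?thesis by (simp add: g_def coord_scale[OF vector_space_fun_scale m3])
  qed
  obtain W es where W: "(W, es) \<in> frames V" "x \<in> W" by (rule vector_bundle_frame[OF V x])
  define B where "B = set (map (\<lambda>e. e x) es)"
  have B: "finite B" "v.independent B" "v.span B = F"
    using vector_bundleD(5)[OF V W] by (auto simp: is_basis_def B_def F_def)
  interpret compatible_space "scale V" F b' g B
    using comp' B two_neq_zero_of_CHAR[OF char] vector_bundleD(2)[OF V x]
    by unfold_locales (auto simp: compatible_def F_def)
  have abc: "e1 x \<in> F" "e2 x \<in> F" "e3 x \<in> F" using a b c by (auto simp: F_def)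
  have gamma0: "\<gamma> x u v w = 0 \<longleftrightarrow> g u v w = 0" if "u \<in> F" "v \<in> F" "w \<in> F" for u v w
    using gamma[OF that] m3 by simp
  have "{v \<in> F. \<forall>w\<in>F. g v (e1 x) w = 0} = kernel_fibre V \<gamma> (L 1) x"
    unfolding kernel_fibre_def a(2) F_def[symmetric] using abc
    by (auto simp: gamma0 gamma_scale image_iff)
  also have "\<dots> = {scale V p (e1 x) + scale V q (e2 x) + scale V r (e3 x) | p q r. True}"
    unfolding kernel[OF x, symmetric] a(2) b(2) c(2) by blast
  finally have ker: "{v \<in> F. \<forall>w\<in>F. g v (e1 x) w = 0} =
    {scale V p (e1 x) + scale V q (e2 x) + scale V r (e3 x) | p q r. True}" .
  have notin: "e1 x \<notin> v.span {e2 x}"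
  proof
    assume "e1 x \<in> v.span {e2 x}"
    then have "e1 x \<in> fibre (L 2) x" by (simp add: v.span_singleton b(2))
    moreover have "e1 x \<in> fibre (L 1) x" using line_frame_in_fibre(2)[OF L[OF i(1)] U1] .
    moreover have "0 \<in> fibre (L k) x" if "k \<in> I" for k
      using vector_bundleD(2)[OF L[OF that] x] scale_L[OF that] by (simp add: v.subspace_0)
    ultimately have "e1 x = 0"
      using direct_sum_fibres_independent[OF splitting I(1) i(1,2) _ x] a(3) by simp
    then show False using a(1) by simp
  qed
  then have "e1 x \<noteq> e2 x" using v.span_base[of "e2 x" "{e2 x}"] by auto
  moreover have "v.independent {e1 x, e2 x}"
    using notin b(1) by (simp add: v.independent_insert)
  ultimately obtain p where p: "p \<noteq> 0" "\<And>w. w \<in> F \<Longrightarrow> g (e2 x) (e3 x) w = p * b' (e1 x) w"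
    using cross_kernel_plane[OF abc ker] by blast
  have "\<gamma> x (e2 x) (e3 x) w = fun_scale (p * t) (mmm.pt (\<beta> x (e1 x) w) (m x))" if "w \<in> F" for w
  proof -
    have "\<gamma> x (e2 x) (e3 x) w = fun_scale (p * b' (e1 x) w) (mmm.pt m2 (m0 x))"
      using gamma p abc that by (simp add: m3_def)
    also have "\<dots> = fun_scale p (mmm.pt (\<beta> x (e1 x) w) (m0 x))"
      using beta abc that by (simp add: mmm.pure_tensor_scale_left)
    finally show ?thesis by (simp add: t mmm.pure_tensor_scale_right)
  qed
  then show ?thesis using p(1) t0 by (intro exI[of _ "p * t"]) (simp add: F_def)
qed

lemma gamma_contract_pure:
  assumes x: "x \<in> topspace (topol X)" and "u \<in> fibre V x" "v \<in> fibre V x"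
  shows "gamma_contract V \<gamma> x (pure_tensor (scale V) (scale V) u v) =
    (\<lambda>w. if w \<in> fibre V x then \<gamma> x u v w else 0)"
  unfolding gamma_contract_def
proof (rule vv.tensor_lift_pure[OF vector_space_pointwise[OF vector_space_fun_scale]])
  note lin = \<gamma>[unfolded alternating_form_def alternating_on_def, THEN conjunct1, rule_format, OF x,
    THEN conjunct1, rule_format, unfolded tensor_bundle_simps]
  show "linear_on (scale V) (\<lambda>c f w. fun_scale c (f w)) (fibre V x) UNIV
      (\<lambda>v w. if w \<in> fibre V x then \<gamma> x u v w else 0)" if "u \<in> fibre V x" for u
    using lin that by (intro bilinear_extended_by_zero[OF vector_space_fun_scale]) blast
  show "linear_on (scale V) (\<lambda>c f w. fun_scale c (f w)) (fibre V x) UNIV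
      (\<lambda>v w. if w \<in> fibre V x then \<gamma> x v u w else 0)" if "u \<in> fibre V x" for u
    using lin that by (intro bilinear_extended_by_zero[OF vector_space_fun_scale]) blast
qed (use assms vector_bundleD(2)[OF V x] in auto)

lemma beta_linear:
  assumes x: "x \<in> topspace (topol X)" and w: "w \<in> fibre V x"
  shows "linear_on (scale V) fun_scale (fibre V x) UNIV (\<lambda>v. \<beta> x v w)"
proof -
  have sym: "symmetric_on (scale V) fun_scale (fibre V x) (fibre (tensor_square M) x) (\<beta> x)"
    using \<beta> x by (simp add: symmetric_bilinear_form_def)
  then show ?thesis
    using w vector_bundleD(2)[OF V x] unfolding symmetric_on_def linear_on_def
    by (simp add: v.subspace_add v.subspace_scale)
qed

lemma beta_ident_pure:
  assumes x: "x \<in> topspace (topol X)" and "v \<in> fibre V x" "n \<in> fibre M x"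
  shows "beta_ident V M \<beta> x (pure_tensor (scale V) (scale M) v n) =
    (\<lambda>w. if w \<in> fibre V x then pure_tensor fun_scale (scale M) (\<beta> x v w) n else 0)"
  unfolding beta_ident_def tensor_bundle_simps
proof (rule vm.tensor_lift_pure[OF vector_space_pointwise[OF vector_space_fun_scale]])
  show "linear_on (scale M) (\<lambda>c f w. fun_scale c (f w)) (fibre M x) UNIV
      (\<lambda>n w. if w \<in> fibre V x then pure_tensor fun_scale (scale M) (\<beta> x v w) n else 0)" for v
    by (intro bilinear_extended_by_zero[OF vector_space_fun_scale, where H = UNIV])
      (simp add: linear_on_def mmm.pure_tensor_add_right mmm.pure_tensor_scale_right)
  show "linear_on (scale V) (\<lambda>c f w. fun_scale c (f w)) (fibre V x) UNIV
      (\<lambda>v w. if w \<in> fibre V x then pure_tensor fun_scale (scale M) (\<beta> x v w) n else 0)" for n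
    using beta_linear[OF x]
    by (intro bilinear_extended_by_zero[OF vector_space_fun_scale, where H = UNIV])
      (simp add: linear_on_def mmm.pure_tensor_add_left mmm.pure_tensor_scale_left)
qed (use assms vector_bundleD(2)[OF V x] vector_bundleD(2)[OF M x] in auto)

text \<open>Elements of \<open>V \<otimes> M\<close> are of the form \<open>v \<otimes> m\<close> for a fixed frame \<open>m\<close>, so injectivity reduces to
  nondegeneracy of \<open>\<beta>\<close>.\<close>
lemma beta_ident_inj:
  assumes x: "x \<in> topspace (topol X)"
  shows "inj_on (beta_ident V M \<beta> x) (fibre (V \<otimes>\<^sub>B M) x)"
proof (rule inj_onI)
  fix t t' assume t: "t \<in> fibre (V \<otimes>\<^sub>B M) x" "t' \<in> fibre (V \<otimes>\<^sub>B M) x"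
    and eq: "beta_ident V M \<beta> x t = beta_ident V M \<beta> x t'"
  note subV = vector_bundleD(2)[OF V x]
  obtain U m where U: "(U, [m]) \<in> frames M" "x \<in> U" by (rule line_bundle_frame[OF M x])
  note m = line_frame_fibre(1,2)[OF M U] line_frame_in_fibre(2)[OF M U]
  have "\<exists>v\<in>fibre V x. s = vm.pt v (m x)" if "s \<in> fibre (V \<otimes>\<^sub>B M) x" for s
    using vm.tensor_space_line_right[OF subV, of s "m x"] that m(2) by simp
  then obtain v v' where v: "v \<in> fibre V x" "v' \<in> fibre V x" "t = vm.pt v (m x)" "t' = vm.pt v' (m x)"
    using t by metis
  have diff: "v - v' \<in> fibre V x" using v subV by (simp add: v.subspace_diff)
  have "\<beta> x (v - v') w = 0" if w: "w \<in> fibre V x" for w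
  proof -
    have "mmm.pt (\<beta> x v w) (m x) = mmm.pt (\<beta> x v' w) (m x)"
      using fun_cong[OF eq, of w] w v m(3) x by (simp add: beta_ident_pure)
    moreover have "\<beta> x v w = \<beta> x (v - v') w + \<beta> x v' w"
      using beta_linear[OF x w] diff v(2) unfolding linear_on_def
      by (metis diff_add_cancel)
    ultimately have "mmm.pt (\<beta> x (v - v') w) (m x) = 0"
      by (simp add: mmm.pure_tensor_add_left)
    then show ?thesis using m(1) by (simp add: mmm.pure_tensor_eq_0_iff)
  qed
  then have "v - v' = 0"
    using nondegenerate x diff unfolding nondegenerate_form_def nondegenerate_on_def by blast
  then show "t = t'" using v by simp
qed

text \<open>By injectivity of the identification it is enough to exhibit a preimage of the contraction.\<close>
lemma induced_map_on_frame:
  assumes U1: "(U1, [e1]) \<in> frames (L 1)" "x \<in> U1" and U2: "(U2, [e2]) \<in> frames (L 2)" "x \<in> U2"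
    and U3: "(U3, [e3]) \<in> frames (L 3)" "x \<in> U3" and UM: "(UM, [m]) \<in> frames M" "x \<in> UM"
    and p: "\<And>w. w \<in> fibre V x \<Longrightarrow> \<gamma> x (e2 x) (e3 x) w =
      fun_scale p (pure_tensor fun_scale (scale M) (\<beta> x (e1 x) w) (m x))"
  shows "induced_map V M \<gamma> \<beta> x (fun_scale k (pure_tensor (scale V) (scale V) (e2 x) (e3 x))) =
    fun_scale (k * p) (pure_tensor (scale V) (scale M) (e1 x) (m x))"
proof -
  have x: "x \<in> topspace (topol X)" using vector_bundleD(3)[OF M UM(1)] UM(2) openin_subset by blast
  note subV = vector_bundleD(2)[OF V x]
  have i: "1 \<in> I" "2 \<in> I" "3 \<in> I" using I by auto
  note e = line_frame_L(3)[OF i(1) U1] line_frame_L(3)[OF i(2) U2] line_frame_L(3)[OF i(3) U3]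
  note m = line_frame_in_fibre(2)[OF M UM]
  have scal: "scale V c v \<in> fibre V x" if "v \<in> fibre V x" for c v
    using subV that by (rule v.subspace_scale)
  let ?t = "vm.pt (scale V (k * p) (e1 x)) (m x)"
  have "gamma_contract V \<gamma> x (vv.pt (scale V k (e2 x)) (e3 x)) = beta_ident V M \<beta> x ?t"
  proof
    fix w
    have "\<gamma> x (scale V k (e2 x)) (e3 x) w = mmm.pt (\<beta> x (scale V (k * p) (e1 x)) w) (m x)"
      if w: "w \<in> fibre V x"
    proof -
      have "linear_on (scale V) fun_scale (fibre V x) (fibre (tensor_cube M) x) (\<lambda>u. \<gamma> x u (e3 x) w)"
        using \<gamma> x e w by (simp add: alternating_form_def alternating_on_def)
      then have "\<gamma> x (scale V k (e2 x)) (e3 x) w = fun_scale k (\<gamma> x (e2 x) (e3 x) w)"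
        using e by (simp add: linear_on_def)
      also have "\<dots> = mmm.pt (fun_scale (k * p) (\<beta> x (e1 x) w)) (m x)"
        by (simp add: p[OF w] mmm.pure_tensor_scale_left)
      also have "fun_scale (k * p) (\<beta> x (e1 x) w) = \<beta> x (scale V (k * p) (e1 x)) w"
        using beta_linear[OF x w] e by (simp add: linear_on_def)
      finally show ?thesis .
    qed
    then show "gamma_contract V \<gamma> x (vv.pt (scale V k (e2 x)) (e3 x)) w = beta_ident V M \<beta> x ?t w"
      using e m scal x by (simp add: gamma_contract_pure beta_ident_pure)
  qed
  moreover have "?t \<in> fibre (V \<otimes>\<^sub>B M) x"
    using e m scal by (simp add: vm.pure_tensor_in_space)
  ultimately have "induced_map V M \<gamma> \<beta> x (vv.pt (scale V k (e2 x)) (e3 x)) = ?t"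
    unfolding induced_map_def using beta_ident_inj[OF x] by simp
  then show ?thesis by (simp add: vv.pure_tensor_scale_left vm.pure_tensor_scale_left)
qed

text \<open>
  Some member \<open>e\<close> of a frame of \<open>V\<close> pairs nontrivially with \<open>e\<^sub>1\<close> at \<open>x\<close>, because \<open>\<beta>\<close> is nondegenerate.
  If \<open>p\<close> and \<open>q\<close> are the coordinates of \<open>\<gamma>(e\<^sub>2, e\<^sub>3, e)\<close> and \<open>\<beta>(e\<^sub>1, e)\<close>, then \<open>p = h q\<close> and \<open>q\<close> does not
  vanish near \<open>x\<close>.
\<close>
lemma multiplier_regular:
  assumes U1: "(U1, [e1]) \<in> frames (L 1)" "x \<in> U1" and U2: "(U2, [e2]) \<in> frames (L 2)" "x \<in> U2"
    and U3: "(U3, [e3]) \<in> frames (L 3)" "x \<in> U3" and UM: "(UM, [m]) \<in> frames M" "x \<in> UM"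
    and h: "\<And>y w. y \<in> U1 \<inter> U2 \<inter> U3 \<inter> UM \<Longrightarrow> w \<in> fibre V y \<Longrightarrow> \<gamma> y (e2 y) (e3 y) w =
      fun_scale (h y) (pure_tensor fun_scale (scale M) (\<beta> y (e1 y) w) (m y))"
  obtains N where "openin (topol X) N" "x \<in> N" "N \<subseteq> U1 \<inter> U2 \<inter> U3 \<inter> UM" "h \<in> reg X N"
proof -
  have x: "x \<in> topspace (topol X)" using vector_bundleD(3)[OF M UM(1)] UM(2) openin_subset by blast
  have i: "1 \<in> I" "2 \<in> I" "3 \<in> I" using I by auto
  have sh: "sheaf_of_functions X" using X by (rule prevariety_sheaf)
  obtain W es where W: "(W, es) \<in> frames V" "x \<in> W" by (rule vector_bundle_frame[OF V x])
  have "\<exists>e\<in>set es. \<beta> x (e1 x) (e x) \<noteq> 0"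
  proof (rule ccontr)
    assume *: "\<not> ?thesis"
    have e1: "e1 x \<in> fibre V x" using line_frame_L(3)[OF i(1) U1] .
    have span: "fibre V x = v.span (set (map (\<lambda>e. e x) es))"
      using vector_bundleD(5)[OF V W] by (simp add: is_basis_def)
    have sub: "set (map (\<lambda>e. e x) es) \<subseteq> fibre V x" unfolding span by (rule v.span_superset)
    have lin: "linear_on (scale V) fun_scale (fibre V x) (fibre (tensor_square M) x) (\<beta> x (e1 x))"
      using \<beta> x e1 by (simp add: symmetric_bilinear_form_def symmetric_on_def)
    have "w \<in> fibre V x \<and> \<beta> x (e1 x) w = 0" if "w \<in> v.span (set (map (\<lambda>e. e x) es))" for w
      using that
    proof (induction rule: v.span_induct_alt)
      case base
      show ?case
        using linear_on_zero[OF lin v.vector_space_axioms vector_space_fun_scale] span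
        by (simp add: v.span_zero)
    next
      case (step c u v)
      then have u: "u \<in> fibre V x" "\<beta> x (e1 x) u = 0" using sub * by auto
      have "scale V c u \<in> fibre V x" using u by (simp add: span v.span_scale)
      with u step show ?case
        using lin by (auto simp: linear_on_def span v.span_add)
    qed
    then have "\<forall>w\<in>fibre V x. \<beta> x (e1 x) w = 0" using span by auto
    then have "e1 x = 0"
      using nondegenerate x e1 unfolding nondegenerate_form_def nondegenerate_on_def by blast
    then show False using line_frame_L(1)[OF i(1) U1] by simp
  qed
  then obtain e where e: "e \<in> set es" "\<beta> x (e1 x) (e x) \<noteq> 0" by blast
  define N where "N = U1 \<inter> U2 \<inter> U3 \<inter> UM \<inter> W"
  note opens = vector_bundleD(3)[OF L[OF i(1)] U1(1)] vector_bundleD(3)[OF L[OF i(2)] U2(1)]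
    vector_bundleD(3)[OF L[OF i(3)] U3(1)] vector_bundleD(3)[OF M UM(1)] vector_bundleD(3)[OF V W(1)]
  have N: "openin (topol X) N" "x \<in> N" "N \<subseteq> U1" "N \<subseteq> U2" "N \<subseteq> U3" "N \<subseteq> UM" "N \<subseteq> W"
    using opens U1 U2 U3 UM W by (auto simp: N_def)
  have frame_section: "regular_section X V N s"
    if "i \<in> I" "(U, [s]) \<in> frames (L i)" "N \<subseteq> U" for i U s
    using regular_section_restrict[OF sh L[OF that(1)] _ N(1) that(3)]
      regular_section_frame[OF L[OF that(1)] that(2)] L_section[OF that(1)] by simp
  have sec: "regular_section X V N e1" "regular_section X V N e2" "regular_section X V N e3"
    using frame_section[OF i(1) U1(1) N(3)] frame_section[OF i(2) U2(1) N(4)]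
      frame_section[OF i(3) U3(1) N(5)] .
  have sec_e: "regular_section X V N e"
    using regular_section_restrict[OF sh V regular_section_frame[OF V W(1) e(1)] N(1,7)] .
  have gsec: "regular_section X (tensor_cube M) N (\<lambda>y. \<gamma> y (e2 y) (e3 y) (e y))"
    using \<gamma> sec sec_e unfolding alternating_form_def by blast
  have bsec: "regular_section X (tensor_square M) N (\<lambda>y. \<beta> y (e1 y) (e y))"
    using \<beta> sec sec_e unfolding symmetric_bilinear_form_def by blast
  have fr2: "(UM \<inter> UM, [\<lambda>y. mm.pt (m y) (m y)]) \<in> frames (tensor_square M)"
    by (rule tensor_bundle_line_frame[OF UM(1) UM(1)])
  have fr3: "(UM \<inter> UM \<inter> UM, [\<lambda>y. mmm.pt (mm.pt (m y) (m y)) (m y)]) \<in> frames (tensor_cube M)"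
    using tensor_bundle_line_frame[OF fr2 UM(1)] by simp
  have NUM: "N \<inter> (UM \<inter> UM) = N" "N \<inter> (UM \<inter> UM \<inter> UM) = N" using N by auto
  obtain p where p: "p \<in> reg X N"
    "\<And>y. y \<in> N \<Longrightarrow> \<gamma> y (e2 y) (e3 y) (e y) = fun_scale (p y) (mmm.pt (mm.pt (m y) (m y)) (m y))"
    using regular_section_line_coord[OF gsec fr3] unfolding NUM tensor_bundle_simps by metis
  obtain q where q: "q \<in> reg X N"
    "\<And>y. y \<in> N \<Longrightarrow> \<beta> y (e1 y) (e y) = fun_scale (q y) (mm.pt (m y) (m y))"
    using regular_section_line_coord[OF bsec fr2] unfolding NUM tensor_bundle_simps by metis
  have pq: "p y = h y * q y" if y: "y \<in> N" for y
  proof -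
    have "e y \<in> fibre V y" using sec_e y by (simp add: regular_section_def)
    then have "fun_scale (p y) (mmm.pt (mm.pt (m y) (m y)) (m y)) =
        fun_scale (h y * q y) (mmm.pt (mm.pt (m y) (m y)) (m y))"
      using h[of y "e y"] p(2)[OF y] q(2)[OF y] y N by (auto simp: mmm.pure_tensor_scale_left)
    moreover have "m y \<noteq> 0" using line_frame_fibre(1)[OF M UM(1)] y N by auto
    ultimately show ?thesis by (simp add: mmm.pure_tensor_eq_0_iff mm.pure_tensor_eq_0_iff)
  qed
  have "q x \<noteq> 0" using q(2)[OF N(2)] e(2) by auto
  then obtain N' where N': "openin (topol X) N'" "x \<in> N'" "N' \<subseteq> N" "\<And>y. y \<in> N' \<Longrightarrow> q y \<noteq> 0"
    "(\<lambda>y. p y / q y) \<in> reg X N'"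
    by (rule reg_quotient_local[OF X N(1,2) p(1) q(1)]) (rule that)
  have "h \<in> reg X N'"
    by (rule reg_cong[OF sh N'(1,5)]) (use pq N' in auto)
  then show thesis using N' N by (intro that[of N']) auto
qed

theorem induced_map_iso: "bundle_iso X (L 2 \<otimes>\<^sub>B L 3) (L 1 \<otimes>\<^sub>B M) (induced_map V M \<gamma> \<beta>)"
proof -
  have i: "1 \<in> I" "2 \<in> I" "3 \<in> I" using I by auto
  have A: "line_bundle X (L 2 \<otimes>\<^sub>B L 3)" by (intro line_bundle_tensor X L i)
  have B: "line_bundle X (L 1 \<otimes>\<^sub>B M)" by (intro line_bundle_tensor X L M i)
  show ?thesis
  proof (rule line_bundle_iso_local[OF X A B])
    fix x assume x: "x \<in> topspace (topol X)"
    obtain U1 e1 where U1: "(U1, [e1]) \<in> frames (L 1)" "x \<in> U1" by (rule line_bundle_frame[OF L[OF i(1)] x])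
    obtain U2 e2 where U2: "(U2, [e2]) \<in> frames (L 2)" "x \<in> U2" by (rule line_bundle_frame[OF L[OF i(2)] x])
    obtain U3 e3 where U3: "(U3, [e3]) \<in> frames (L 3)" "x \<in> U3" by (rule line_bundle_frame[OF L[OF i(3)] x])
    obtain UM m where UM: "(UM, [m]) \<in> frames M" "x \<in> UM" by (rule line_bundle_frame[OF M x])
    have frA: "(U2 \<inter> U3, [\<lambda>y. vv.pt (e2 y) (e3 y)]) \<in> frames (L 2 \<otimes>\<^sub>B L 3)"
      using tensor_bundle_line_frame[OF U2(1) U3(1)] unfolding scale_L[OF i(2)] scale_L[OF i(3)] .
    have frB: "(U1 \<inter> UM, [\<lambda>y. vm.pt (e1 y) (m y)]) \<in> frames (L 1 \<otimes>\<^sub>B M)"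
      using tensor_bundle_line_frame[OF U1(1) UM(1)] unfolding scale_L[OF i(1)] .
    have "\<forall>y\<in>U1 \<inter> U2 \<inter> U3 \<inter> UM. \<exists>p. p \<noteq> 0 \<and> (\<forall>w\<in>fibre V y. \<gamma> y (e2 y) (e3 y) w =
        fun_scale p (mmm.pt (\<beta> y (e1 y) w) (m y)))"
      using contraction_on_fibre[OF U1(1) _ U2(1) _ U3(1) _ UM(1)] by blast
    then obtain h where h: "\<And>y. y \<in> U1 \<inter> U2 \<inter> U3 \<inter> UM \<Longrightarrow> h y \<noteq> 0"
      "\<And>y w. y \<in> U1 \<inter> U2 \<inter> U3 \<inter> UM \<Longrightarrow> w \<in> fibre V y \<Longrightarrow> \<gamma> y (e2 y) (e3 y) w =
        fun_scale (h y) (mmm.pt (\<beta> y (e1 y) w) (m y))"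
      by metis
    have ind: "induced_map V M \<gamma> \<beta> y (fun_scale k (vv.pt (e2 y) (e3 y))) =
        fun_scale (k * h y) (vm.pt (e1 y) (m y))" if "y \<in> U1 \<inter> U2 \<inter> U3 \<inter> UM" for y k
      using induced_map_on_frame[OF U1(1) _ U2(1) _ U3(1) _ UM(1)] h(2)[OF that] that by blast
    have xN: "x \<in> U1 \<inter> U2 \<inter> U3 \<inter> UM" "x \<in> U2 \<inter> U3" "x \<in> U1 \<inter> UM" using U1 U2 U3 UM by auto
    have mem: "fun_scale k (vm.pt (e1 x) (m x)) \<in> fibre (L 1 \<otimes>\<^sub>B M) x" for k
      using line_frame_in_fibre(1)[OF B frB xN(3)] by simp
    show "linear_on (scale (L 2 \<otimes>\<^sub>B L 3)) (scale (L 1 \<otimes>\<^sub>B M)) (fibre (L 2 \<otimes>\<^sub>B L 3) x)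
        (fibre (L 1 \<otimes>\<^sub>B M) x) (induced_map V M \<gamma> \<beta> x)"
      unfolding linear_on_def line_frame_fibre(3)[OF A frA xN(2)] tensor_bundle_simps(1) ball_simps
    proof (intro conjI allI)
      fix a b
      show "induced_map V M \<gamma> \<beta> x (fun_scale a (vv.pt (e2 x) (e3 x))) \<in> fibre (L 1 \<otimes>\<^sub>B M) x"
        unfolding ind[OF xN(1)] by (rule mem)
      show "induced_map V M \<gamma> \<beta> x (fun_scale a (vv.pt (e2 x) (e3 x)) + fun_scale b (vv.pt (e2 x) (e3 x))) =
        induced_map V M \<gamma> \<beta> x (fun_scale a (vv.pt (e2 x) (e3 x))) +
        induced_map V M \<gamma> \<beta> x (fun_scale b (vv.pt (e2 x) (e3 x)))"
        unfolding fun_scale_add[symmetric] ind[OF xN(1)] distrib_right ..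
      show "induced_map V M \<gamma> \<beta> x (fun_scale a (fun_scale b (vv.pt (e2 x) (e3 x)))) =
        fun_scale a (induced_map V M \<gamma> \<beta> x (fun_scale b (vv.pt (e2 x) (e3 x))))"
        unfolding fun_scale_scale ind[OF xN(1)] mult.assoc ..
    qed
    obtain N where N: "openin (topol X) N" "x \<in> N" "N \<subseteq> U1 \<inter> U2 \<inter> U3 \<inter> UM" "h \<in> reg X N"
      using multiplier_regular[OF U1 U2 U3 UM h(2)] by blast
    have "h y \<noteq> 0 \<and>
        induced_map V M \<gamma> \<beta> y (vv.pt (e2 y) (e3 y)) = fun_scale (h y) (vm.pt (e1 y) (m y))"
      if "y \<in> N" for y
    proof -
      have y: "y \<in> U1 \<inter> U2 \<inter> U3 \<inter> UM" using N(3) that by blast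
      show ?thesis using ind[OF y, of 1] h(1)[OF y] by simp
    qed
    then show "\<exists>h. multiplier_at X (L 2 \<otimes>\<^sub>B L 3) (L 1 \<otimes>\<^sub>B M) (induced_map V M \<gamma> \<beta>) x h"
      by (intro exI[of _ h] multiplier_atI[OF frA frB N(1,2) _ N(4)]) (use N(3) in auto)
  qed
qed

end

theorem proposition3p16:
  fixes X :: "('k::alg_closed_field, 'x) fun_space"
    and V :: "('k, 'x, 'v::ab_group_add) vbundle"
    and M :: "('k, 'x, 'm::ab_group_add) vbundle"
    and L :: "nat \<Rightarrow> ('k, 'x, 'v) vbundle"
    and \<gamma> :: "'x \<Rightarrow> 'v \<Rightarrow> 'v \<Rightarrow> 'v \<Rightarrow> ('k, ('k, 'm, 'm) tensor, 'm) tensor"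
    and \<beta> :: "'x \<Rightarrow> 'v \<Rightarrow> 'v \<Rightarrow> ('k, 'm, 'm) tensor"
  assumes "CHAR('k) \<noteq> 2"
    and "variety X"
    and "vector_bundle X 7 V"
    and "line_bundle X M"
    and "alternating_form X V (tensor_cube M) \<gamma>"
    and "symmetric_bilinear_form X V (tensor_square M) \<beta>"
    and "nondegenerate_form X V \<beta>"
    and "locally_compatible X V M \<gamma> \<beta>"
    and "\<forall>i\<in>{1..7}. line_bundle X (L i)"
    and "is_direct_sum X {1..7} L V"
    and "isotropic_line_subbundle X V \<gamma> (L 1)"
    and "\<forall>x\<in>topspace (topol X).
           {a + b + c | a b c. a \<in> fibre (L 1) x \<and> b \<in> fibre (L 2) x \<and> c \<in> fibre (L 3) x}
             = kernel_fibre V \<gamma> (L 1) x"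
  shows "bundle_iso X (L 2 \<otimes>\<^sub>B L 3) (L 1 \<otimes>\<^sub>B M) (induced_map V M \<gamma> \<beta>)"
proof -
  interpret kernel_splitting X V M 7 "{1..7}" L \<gamma> \<beta>
    by (intro kernel_splitting.intro) (use assms in \<open>auto simp: variety_def\<close>)
  show ?thesis by (rule induced_map_iso)
qed

end
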